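(* Let $\mathfrak{n}$ be the necklace Lie algebra in $2d$ variables, let $V=\mathbb{C}x_1\oplus\dots\oplus\mathbb{C}x_d\oplus\mathbb{C}x_1^*\oplus\dots\oplus\mathbb{C}x_d^*$, and let $V_n^c=V^{\otimes n}/C_n$ where $C_n=\langle v_1\otimes\dots\otimes v_n-v_2\otimes\dots\otimes v_n\otimes v_1\mid v_1,\dots,v_n\in V\rangle$. Consider $\mathfrak{n}_n$ as an $\mathfrak{sp}(2d)$-module through the canonical identification $\mathfrak{n}_2\cong\mathfrak{sp}(2d)$. Then the canonical identification $$V_n^c\to\mathfrak{n}_n:\ v_1\otimes\dots\otimes v_n\mapsto v_1\cdots v_n$$ is an isomorphism of $\mathfrak{sp}(2d)$-modules.
   Context: Let $A=\mathbb{C}\langle x_1,\dots,x_d,x_1^*,\dots,x_d^*\rangle$. The canonical symplectic double bracket on $A$ is the bilinear map $\{\!\{-,-\}\!\}:A\otimes A\to A\otimes A$ determined by $\{\!\{x_i,x_j\}\!\}=\{\!\{x_i^*,x_j^*\}\!\}=0$, $\{\!\{x_i,x_j^*\}\!\}=0$ for $i\ne j$, $\{\!\{x_i,x_i^*\}\!\}=1\otimes 1$, together with $\{\!\{a,b\}\!\}=-\{\!\{b,a\}\!\}^{o}$ (where $(u\otimes v)^o=v\otimes u$) and $\{\!\{a,bc\}\!\}=b\{\!\{a,c\}\!\}+\{\!\{a,b\}\!\}c$ for the outer bimodule structure $a(u\otimes v)c=(au)\otimes(vc)$. With $\mu$ the multiplication of $A$, put $\{a,b\}_L=\mu(\{\!\{a,b\}\!\})$;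 it induces a Lie bracket on the vector space quotient $\mathfrak{n}=A/[A,A]$ ($[A,A]$ = span of commutators), the necklace Lie algebra in $2d$ variables, graded by word length, with bracket of degree $-2$. Thus $\mathfrak{n}_2$ is a Lie subalgebra acting on each $\mathfrak{n}_n$ by the bracket. The polynomial algebra $\mathbb{C}[x_1,\dots,x_d,x_1^*,\dots,x_d^*]$ carries the Poisson bracket with $\{x_i,x_j\}=\{x_i^*,x_j^*\}=0$, $\{x_i,x_j^*\}=\delta_{ij}$; its space of homogeneous quadratic polynomials is a Lie algebra identified with $\mathfrak{sp}(2d)$, and it acts on $V$ (the linear polynomials) by the Poisson bracket, $g.v=\{g,v\}$. The canonical identification $\mathfrak{n}_2\cong\mathfrak{sp}(2d)$ is the map sending a word of length two to the corresponding commutative monomial. The action on $V^{\otimes n}$ is $g.(v_1\otimes\dots\otimes v_n)=\sum_{i=1}^n v_1\otimes\dots\otimes v_{i-1}\otimes g.v_i\otimes v_{i+1}\otimes\dots\otimes v_n$; the subspace $C_n$ is an $\mathfrak{sp}(2d)$-submodule, so $V_n^c$ is an $\mathfrak{sp}(2d)$-module. *)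

theory Defs
  imports
    Complex_Main
    "HOL-Library.Poly_Mapping"
    "HOL-Library.Product_Plus"
    "HOL-Library.Set_Algebras"
    "HOL-Algebra.Module"
begin

section \<open>Complex vector spaces with a basis\<close>

text \<open>
  Vector spaces with a distinguished basis \<open>'k\<close> are modelled as finitely supported functions
  \<open>'k \<Rightarrow>\<^sub>0 complex\<close>; if \<open>'k\<close> is a monoid, the product of \<^theory>\<open>HOL-Library.Poly_Mapping\<close>
  makes this the monoid algebra.
\<close>

definition cscale :: "complex \<Rightarrow> ('k \<Rightarrow>\<^sub>0 complex) \<Rightarrow> ('k \<Rightarrow>\<^sub>0 complex)" where
  "cscale c p = Poly_Mapping.map ((*) c) p"

lemma lookup_cscale [simp]: "Poly_Mapping.lookup (cscale c p) k = c * Poly_Mapping.lookup p k"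
  by (simp add: cscale_def Poly_Mapping.map.rep_eq when_def)

global_interpretation cpm: vector_space "cscale :: complex \<Rightarrow> ('k \<Rightarrow>\<^sub>0 complex) \<Rightarrow> _"
  by unfold_locales (auto intro!: poly_mapping_eqI simp: lookup_add algebra_simps)

abbreviation basis :: "'k \<Rightarrow> ('k \<Rightarrow>\<^sub>0 complex)" where
  "basis k \<equiv> Poly_Mapping.single k 1"

abbreviation clinear :: "(('k \<Rightarrow>\<^sub>0 complex) \<Rightarrow> ('l \<Rightarrow>\<^sub>0 complex)) \<Rightarrow> bool" where
  "clinear \<equiv> Vector_Spaces.linear cscale cscale"

definition lin_ext :: "('k \<Rightarrow> ('l \<Rightarrow>\<^sub>0 complex)) \<Rightarrow> ('k \<Rightarrow>\<^sub>0 complex) \<Rightarrow> ('l \<Rightarrow>\<^sub>0 complex)" where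
  "lin_ext f p = (\<Sum>k\<in>Poly_Mapping.keys p. cscale (Poly_Mapping.lookup p k) (f k))"

lemma lin_ext_superset:
  assumes "finite K" "Poly_Mapping.keys p \<subseteq> K"
  shows "lin_ext f p = (\<Sum>k\<in>K. cscale (Poly_Mapping.lookup p k) (f k))"
  unfolding lin_ext_def
  by (rule sum.mono_neutral_left) (use assms in \<open>auto simp: in_keys_iff\<close>)

lemma lin_ext_add: "lin_ext f (p + q) = lin_ext f p + lin_ext f q"
proof -
  define K where "K = Poly_Mapping.keys p \<union> Poly_Mapping.keys q"
  have "finite K" "Poly_Mapping.keys p \<subseteq> K" "Poly_Mapping.keys q \<subseteq> K" "Poly_Mapping.keys (p + q) \<subseteq> K"
    using Poly_Mapping.keys_add[of p q] by (auto simp: K_def)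
  then show ?thesis
    by (simp add: lin_ext_superset[of K] lookup_add cpm.scale_left_distrib sum.distrib)
qed

lemma lin_ext_cscale: "lin_ext f (cscale c p) = cscale c (lin_ext f p)"
proof -
  have "Poly_Mapping.keys (cscale c p) \<subseteq> Poly_Mapping.keys p"
    by (auto simp: in_keys_iff)
  then show ?thesis
    by (simp add: lin_ext_superset[of "Poly_Mapping.keys p"] cpm.scale_sum_right)
qed

lemma clinearI:
  assumes "\<And>p q. F (p + q) = F p + F q" "\<And>c p. F (cscale c p) = cscale c (F p)"
  shows "clinear F"
  using assms by unfold_locales auto

lemma clinear_lin_ext: "clinear (lin_ext f)"
  by (intro clinearI lin_ext_add lin_ext_cscale)

lemma lin_ext_single [simp]: "lin_ext f (Poly_Mapping.single k c) = cscale c (f k)"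
  by (simp add: lin_ext_def)

lemma basis_expansion: "(\<Sum>k\<in>Poly_Mapping.keys p. cscale (Poly_Mapping.lookup p k) (basis k)) = p"
  by (rule poly_mapping_eqI)
    (auto simp: lookup_sum lookup_single when_def in_keys_iff if_distrib cong: if_cong)

lemma clinear_add: "clinear F \<Longrightarrow> F (p + q) = F p + F q"
  and clinear_cscale: "clinear F \<Longrightarrow> F (cscale c p) = cscale c (F p)"
  by (simp_all add: Vector_Spaces.linear_iff)

lemma clinear_0: "clinear F \<Longrightarrow> F 0 = 0"
  using clinear_add[of F 0 0] by simp

lemma clinear_minus: "clinear F \<Longrightarrow> F (- p) = - F p"
  using clinear_add[of F p "- p"] clinear_0[of F] by (simp add: eq_neg_iff_add_eq_0 add.commute)

lemma clinear_diff: "clinear F \<Longrightarrow> F (p - q) = F p - F q"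
  using clinear_add[of F p "- q"] clinear_minus[of F q] by simp

lemma clinear_sum:
  assumes "clinear F"
  shows "F (sum g S) = (\<Sum>s\<in>S. F (g s))"
  by (induction S rule: infinite_finite_induct) (simp_all add: clinear_add[OF assms] clinear_0[OF assms])

lemma clinear_eq_lin_ext:
  assumes "clinear F"
  shows "F p = lin_ext (\<lambda>k. F (basis k)) p"
proof -
  have "F p = F (\<Sum>k\<in>Poly_Mapping.keys p. cscale (Poly_Mapping.lookup p k) (basis k))"
    by (simp only: basis_expansion)
  also have "\<dots> = lin_ext (\<lambda>k. F (basis k)) p"
    by (simp only: clinear_sum[OF assms] clinear_cscale[OF assms] lin_ext_def)
  finally show ?thesis .
qed

lemma clinear_eqI:
  assumes "clinear F" "clinear G" "\<And>k. F (basis k) = G (basis k)"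
  shows "F p = G p"
  unfolding clinear_eq_lin_ext[OF assms(1), of p] clinear_eq_lin_ext[OF assms(2), of p] assms(3) ..

lemma clinear_id: "clinear (\<lambda>p. p)"
  and clinear_scale_const: "clinear (cscale c)"
  by (auto intro!: clinearI simp: cpm.scale_right_distrib mult.commute)

lemma clinear_compose:
  assumes "clinear F" "clinear G"
  shows "clinear (\<lambda>p. F (G p))"
  by (rule clinearI)
    (simp_all add: clinear_add[OF assms(1)] clinear_add[OF assms(2)]
      clinear_cscale[OF assms(1)] clinear_cscale[OF assms(2)])

lemma clinear_plus:
  assumes "clinear F" "clinear G"
  shows "clinear (\<lambda>p. F p + G p)"
  by (rule clinearI)
    (simp_all add: clinear_add[OF assms(1)] clinear_add[OF assms(2)]
      clinear_cscale[OF assms(1)] clinear_cscale[OF assms(2)] cpm.scale_right_distrib)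

lemma clinear_uminus:
  assumes "clinear F"
  shows "clinear (\<lambda>p. - F p)"
  by (rule clinearI) (simp_all add: clinear_add[OF assms] clinear_cscale[OF assms])

lemma clinear_minus':
  assumes "clinear F" "clinear G"
  shows "clinear (\<lambda>p. F p - G p)"
  using clinear_plus[OF assms(1) clinear_uminus[OF assms(2)]] by simp

lemma clinear_zero: "clinear (\<lambda>p. 0)"
  by (rule clinearI) simp_all

lemma clinear_sum':
  assumes "\<And>s. s \<in> S \<Longrightarrow> clinear (G s)"
  shows "clinear (\<lambda>p. \<Sum>s\<in>S. G s p)"
  using assms
  by (induction S rule: infinite_finite_induct) (simp_all add: clinear_zero clinear_plus)

lemma clinear_lin_ext_param:
  assumes "\<And>k. clinear (f k)"
  shows "clinear (\<lambda>q. lin_ext (\<lambda>k. f k q) p)"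
  unfolding lin_ext_def
  by (intro clinear_sum' clinear_compose[OF clinear_scale_const] assms)

lemma cscale_conv_mult: "cscale c p = Poly_Mapping.single 0 c * (p :: 'k::monoid_add \<Rightarrow>\<^sub>0 complex)"
  by (simp add: cscale_def mult_map_scale_conv_mult)

lemma single_0_central:
  "p * Poly_Mapping.single 0 c = Poly_Mapping.single 0 c * (p :: 'k::monoid_add \<Rightarrow>\<^sub>0 complex)"
proof -
  have "cscale a (basis k) * Poly_Mapping.single 0 c = Poly_Mapping.single 0 c * cscale a (basis k)"
    for a :: complex and k :: 'k
    by (simp add: cscale_def mult_single mult.commute)
  then show ?thesis
    by (subst (1 2) basis_expansion[of p, symmetric]) (simp only: sum_distrib_left sum_distrib_right)
qed

lemma cscale_mult_left: "cscale c p * q = cscale c (p * q)" for p :: "'k::monoid_add \<Rightarrow>\<^sub>0 complex"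
  by (simp add: cscale_conv_mult mult.assoc)

lemma cscale_mult_right: "p * cscale c q = cscale c (p * q)" for p :: "'k::monoid_add \<Rightarrow>\<^sub>0 complex"
  by (metis cscale_conv_mult mult.assoc single_0_central)

lemma clinear_mult_left: "clinear (\<lambda>p. p * q)"
  and clinear_mult_right: "clinear (\<lambda>p. q * p)" for q :: "'k::monoid_add \<Rightarrow>\<^sub>0 complex"
  by (auto intro!: clinearI simp: algebra_simps cscale_mult_left cscale_mult_right)

subsection \<open>Quotients\<close>

definition quotient_carrier :: "'a::ab_group_add set \<Rightarrow> 'a set \<Rightarrow> 'a set set" where
  "quotient_carrier U W = (\<lambda>u. u +o W) ` U"

text \<open>The map between quotients induced by \<open>f\<close> if \<open>f\<close> is linear and respects the subspaces (see
  \<open>quotient_map_coset\<close> below).\<close>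

definition quotient_map :: "'b::ab_group_add set \<Rightarrow> ('a \<Rightarrow> 'b) \<Rightarrow> 'a set \<Rightarrow> 'b set" where
  "quotient_map W f S = (\<Union>s\<in>S. f s +o W)"

lemma coset_eq_iff:
  assumes "cpm.subspace W"
  shows "a +o W = b +o W \<longleftrightarrow> a - b \<in> W"
proof
  assume "a +o W = b +o W"
  moreover have "a + 0 \<in> a +o W"
    using cpm.subspace_0[OF assms] by (auto simp: elt_set_plus_def)
  ultimately show "a - b \<in> W"
    by (auto simp: elt_set_plus_def)
next
  assume *: "a - b \<in> W"
  have **: "b - a \<in> W"
    using cpm.subspace_neg[OF assms *] by simp
  have "b +o W \<subseteq> a +o W" if "a - b \<in> W" "b - a \<in> W" for a b
  proof
    fix x assume "x \<in> b +o W"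
    then obtain w where w: "w \<in> W" "x = b + w"
      by (auto simp: elt_set_plus_def)
    then have "x = a + ((b - a) + w)" "(b - a) + w \<in> W"
      using cpm.subspace_add[OF assms that(2)] by auto
    then show "x \<in> a +o W"
      unfolding elt_set_plus_def by blast
  qed
  from this[OF * **] this[OF ** *] show "a +o W = b +o W"
    by (rule equalityI[rotated])
qed

lemma coset_add:
  assumes "cpm.subspace W"
  shows "(a +o W) + (b +o W) = (a + b) +o W"
proof -
  have "W + W = W"
    using cpm.subspace_add[OF assms] cpm.subspace_0[OF assms]
    by (force simp: set_plus_def)
  then show ?thesis
    by (simp add: set_plus_rearrange)
qed

lemma quotient_map_coset:
  assumes "clinear f" "cpm.subspace W" "cpm.subspace W'" "f ` W \<subseteq> W'"
  shows "quotient_map W' f (a +o W) = f a +o W'"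
proof -
  have "f s +o W' = f a +o W'" if "s \<in> a +o W" for s
  proof -
    from that obtain w where "w \<in> W" "s = a + w"
      by (auto simp: elt_set_plus_def)
    then have "f s - f a \<in> W'"
      using assms(4) by (auto simp: clinear_add[OF assms(1)])
    then show ?thesis
      by (simp add: coset_eq_iff[OF assms(3)])
  qed
  moreover have "a \<in> a +o W"
    using cpm.subspace_0[OF assms(2)] by (force simp: elt_set_plus_def)
  ultimately show ?thesis
    unfolding quotient_map_def by blast
qed

section \<open>The free algebra and its symplectic double bracket\<close>

text \<open>The generators \<open>x\<^sub>i\<close>, \<open>x\<^sub>i\<^sup>*\<close>, indexed by a finite type \<open>'d\<close>, so that \<open>d = CARD('d)\<close>.\<close>

datatype 'd gen = X 'd | Xstar 'd

instance gen :: (finite) finite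
proof
  have "(UNIV :: 'a gen set) = range X \<union> range Xstar"
    by (metis UNIV_eq_I UnCI gen.exhaust rangeI)
  then show "finite (UNIV :: 'a gen set)"
    by (metis finite_Un finite_imageI finite)
qed

datatype 'g free_monoid = Word (letters: "'g list")

instantiation free_monoid :: (type) monoid_add
begin

definition zero_free_monoid :: "'a free_monoid" where
  "zero_free_monoid = Word []"

definition plus_free_monoid :: "'a free_monoid \<Rightarrow> 'a free_monoid \<Rightarrow> 'a free_monoid" where
  "plus_free_monoid u v = Word (letters u @ letters v)"

instance
  by standard (simp_all add: zero_free_monoid_def plus_free_monoid_def)

end

lemma letters_0 [simp]: "letters 0 = []"
  and letters_add [simp]: "letters (u + v) = letters u @ letters v"
  by (simp_all add: zero_free_monoid_def plus_free_monoid_def)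

text \<open>\<open>A\<close> and \<open>A \<otimes> A\<close>; words, respectively pairs of words, form a basis.\<close>

type_synonym 'd free_alg = "'d gen free_monoid \<Rightarrow>\<^sub>0 complex"
type_synonym 'd free_alg2 = "('d gen free_monoid \<times> 'd gen free_monoid) \<Rightarrow>\<^sub>0 complex"

definition letter :: "'d gen \<Rightarrow> 'd free_alg" where
  "letter x = basis (Word [x])"

definition tensor2 :: "'d free_alg \<Rightarrow> 'd free_alg \<Rightarrow> 'd free_alg2" where
  "tensor2 a b = lin_ext (\<lambda>u. lin_ext (\<lambda>v. basis (u, v)) b) a"

definition flip2 :: "'d free_alg2 \<Rightarrow> 'd free_alg2" where
  "flip2 = lin_ext (\<lambda>(u, v). basis (v, u))"

definition outer :: "'d free_alg \<Rightarrow> 'd free_alg2 \<Rightarrow> 'd free_alg \<Rightarrow> 'd free_alg2" where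
  "outer a t c = lin_ext (\<lambda>(u, v). tensor2 (a * basis u) (basis v * c)) t"

definition mult2 :: "'d free_alg2 \<Rightarrow> 'd free_alg" where
  "mult2 = lin_ext (\<lambda>(u, v). basis u * basis v)"

fun pairing :: "'d gen \<Rightarrow> 'd gen \<Rightarrow> complex" where
  "pairing (X i) (Xstar j) = (if i = j then 1 else 0)"
| "pairing (Xstar i) (X j) = (if i = j then -1 else 0)"
| "pairing (X i) (X j) = 0"
| "pairing (Xstar i) (Xstar j) = 0"

text \<open>
  The double bracket of two words: each pair of letters \<open>u\<^sub>i\<close>, \<open>w\<^sub>j\<close> is contracted, giving
  \<open>(w\<^sub>1\<dots>w\<^bsub>j-1\<^esub> u\<^bsub>i+1\<^esub>\<dots>u\<^sub>m) \<otimes> (u\<^sub>1\<dots>u\<^bsub>i-1\<^esub> w\<^bsub>j+1\<^esub>\<dots>w\<^sub>n)\<close>. Below this is shown to be the unique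
  solution of the axioms of the canonical symplectic double bracket.
\<close>

definition dbracket_words :: "'d gen list \<Rightarrow> 'd gen list \<Rightarrow> 'd free_alg2" where
  "dbracket_words us ws = (\<Sum>i<length us. \<Sum>j<length ws.
     cscale (pairing (us ! i) (ws ! j))
       (basis (Word (take j ws @ drop (Suc i) us), Word (take i us @ drop (Suc j) ws))))"

definition dbracket :: "'d free_alg \<Rightarrow> 'd free_alg \<Rightarrow> 'd free_alg2" where
  "dbracket a b = lin_ext (\<lambda>u. lin_ext (\<lambda>w. dbracket_words (letters u) (letters w)) b) a"

definition symplectic_double_bracket :: "('d free_alg \<Rightarrow> 'd free_alg \<Rightarrow> 'd free_alg2) \<Rightarrow> bool" where
  "symplectic_double_bracket D \<longleftrightarrow>
     (\<forall>a. clinear (D a)) \<and> (\<forall>b. clinear (\<lambda>a. D a b)) \<and>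
     (\<forall>i j. D (letter (X i)) (letter (X j)) = 0) \<and>
     (\<forall>i j. D (letter (Xstar i)) (letter (Xstar j)) = 0) \<and>
     (\<forall>i j. D (letter (X i)) (letter (Xstar j)) = (if i = j then tensor2 1 1 else 0)) \<and>
     (\<forall>a b. D a b = - flip2 (D b a)) \<and>
     (\<forall>a b c. D a (b * c) = outer b (D a c) 1 + outer 1 (D a b) c)"

lemma basis_0 [simp]: "basis (0 :: 'k::monoid_add) = 1"
  by simp

lemma basis_mult: "basis u * basis v = basis (u + v :: 'k::monoid_add)"
  by (simp add: mult_single)

lemma basis_Word_Cons: "basis (Word (x # xs)) = letter x * basis (Word xs)"
  by (simp add: letter_def basis_mult plus_free_monoid_def)

lemma basis_Word_Nil: "basis (Word []) = 1"
  by (metis single_one zero_free_monoid_def)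

lemma clinear_tensor2_left: "clinear (\<lambda>a. tensor2 a b)"
  and clinear_tensor2_right: "clinear (\<lambda>b. tensor2 a b)"
  and clinear_dbracket_left: "clinear (\<lambda>a. dbracket a b)"
  and clinear_dbracket_right: "clinear (\<lambda>b. dbracket a b)"
  unfolding tensor2_def dbracket_def
  by (intro clinear_lin_ext clinear_lin_ext_param)+

lemma clinear_flip2: "clinear flip2"
  and clinear_mult2: "clinear mult2"
  unfolding flip2_def mult2_def by (rule clinear_lin_ext)+

lemma clinear_outer_left: "clinear (\<lambda>a. outer a t c)"
  and clinear_outer_mid: "clinear (\<lambda>t. outer a t c)"
  and clinear_outer_right: "clinear (\<lambda>c. outer a t c)"
proof -
  have "clinear (\<lambda>a. lin_ext (\<lambda>p. tensor2 (a * basis (fst p)) (basis (snd p) * c)) t)"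
    by (intro clinear_lin_ext_param clinear_compose[OF clinear_tensor2_left clinear_mult_left])
  then show "clinear (\<lambda>a. outer a t c)"
    by (simp add: outer_def split_def)
  show "clinear (\<lambda>t. outer a t c)"
    unfolding outer_def by (rule clinear_lin_ext)
  have "clinear (\<lambda>c. lin_ext (\<lambda>p. tensor2 (a * basis (fst p)) (basis (snd p) * c)) t)"
    by (intro clinear_lin_ext_param clinear_compose[OF clinear_tensor2_right clinear_mult_right])
  then show "clinear (\<lambda>c. outer a t c)"
    by (simp add: outer_def split_def)
qed

lemma tensor2_basis [simp]: "tensor2 (basis u) (basis v) = basis (u, v)"
  by (simp add: tensor2_def)

lemma outer_basis [simp]:
  "outer (basis u) (basis p) (basis v) = basis (u + fst p, snd p + v)"
  by (simp add: outer_def basis_mult case_prod_beta)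

lemma flip2_basis [simp]: "flip2 (basis p) = basis (snd p, fst p)"
  by (simp add: flip2_def case_prod_beta)

lemma mult2_basis [simp]: "mult2 (basis p) = basis (fst p + snd p)"
  by (simp add: mult2_def case_prod_beta basis_mult)

lemma dbracket_basis [simp]: "dbracket (basis u) (basis w) = dbracket_words (letters u) (letters w)"
  by (simp add: dbracket_def)

lemma outer_tensor2: "outer a (tensor2 b b') c = tensor2 (a * b) (b' * c)"
proof -
  have 1: "outer (basis u) (tensor2 (basis v) (basis v')) (basis w) =
      tensor2 (basis u * basis v) (basis v' * basis w)" for u v v' w :: "'a gen free_monoid"
    by (simp add: basis_mult)
  have 2: "outer a (tensor2 (basis v) (basis v')) (basis w) =
      tensor2 (a * basis v) (basis v' * basis w)" for a and v v' w :: "'a gen free_monoid"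
    by (rule clinear_eqI[OF clinear_outer_left
        clinear_compose[OF clinear_tensor2_left clinear_mult_left] 1])
  have 3: "outer a (tensor2 (basis v) (basis v')) c =
      tensor2 (a * basis v) (basis v' * c)" for a c and v v' :: "'a gen free_monoid"
    by (rule clinear_eqI[OF clinear_outer_right
        clinear_compose[OF clinear_tensor2_right clinear_mult_right] 2])
  have 4: "outer a (tensor2 b (basis v')) c = tensor2 (a * b) (basis v' * c)"
    for a b c and v' :: "'a gen free_monoid"
    by (rule clinear_eqI[OF clinear_compose[OF clinear_outer_mid clinear_tensor2_left]
        clinear_compose[OF clinear_tensor2_left clinear_mult_right] 3])
  show ?thesis
    by (rule clinear_eqI[OF clinear_compose[OF clinear_outer_mid clinear_tensor2_right]
        clinear_compose[OF clinear_tensor2_right clinear_mult_left] 4])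
qed

lemma flip2_tensor2: "flip2 (tensor2 a b) = tensor2 b a"
proof -
  have "flip2 (tensor2 (basis u) b) = tensor2 b (basis u)" for u
    by (rule clinear_eqI[OF clinear_compose[OF clinear_flip2 clinear_tensor2_right]
        clinear_tensor2_left]) simp
  then show ?thesis
    by (rule clinear_eqI[OF clinear_compose[OF clinear_flip2 clinear_tensor2_left]
        clinear_tensor2_right])
qed

lemma mult2_tensor2: "mult2 (tensor2 a b) = a * b"
proof -
  have "mult2 (tensor2 (basis u) b) = basis u * b" for u
    by (rule clinear_eqI[OF clinear_compose[OF clinear_mult2 clinear_tensor2_right]
        clinear_mult_right]) (simp add: basis_mult)
  then show ?thesis
    by (rule clinear_eqI[OF clinear_compose[OF clinear_mult2 clinear_tensor2_left]
        clinear_mult_left])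
qed

lemma outer_1_1: "outer 1 t 1 = t"
proof (rule clinear_eqI[OF clinear_outer_mid clinear_id])
  fix p :: "'a gen free_monoid \<times> 'a gen free_monoid"
  show "outer 1 (basis p) 1 = basis p"
    using outer_basis[of 0 p 0] by simp
qed

lemma pairing_antisym: "pairing x y = - pairing y x"
  by (cases x; cases y) auto

lemma dbracket_words_antisym: "dbracket_words us ws = - flip2 (dbracket_words ws us)"
proof -
  have "flip2 (dbracket_words ws us) = (\<Sum>j<length ws. \<Sum>i<length us.
     cscale (pairing (ws ! j) (us ! i))
       (basis (Word (take j ws @ drop (Suc i) us), Word (take i us @ drop (Suc j) ws))))"
    by (simp add: dbracket_words_def clinear_sum[OF clinear_flip2] clinear_cscale[OF clinear_flip2])
  also have "\<dots> = - dbracket_words us ws"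
    unfolding dbracket_words_def sum.swap[of _ "{..<length us}"] sum_negf[symmetric]
    by (subst pairing_antisym) simp
  finally show ?thesis by simp
qed

lemma dbracket_antisym: "dbracket a b = - flip2 (dbracket b a)"
proof -
  have "dbracket (basis u) b = - flip2 (dbracket b (basis u))" for u
    by (rule clinear_eqI[OF clinear_dbracket_right
        clinear_uminus[OF clinear_compose[OF clinear_flip2 clinear_dbracket_left]]])
      (simp flip: dbracket_words_antisym)
  then show ?thesis
    by (rule clinear_eqI[OF clinear_dbracket_left
        clinear_uminus[OF clinear_compose[OF clinear_flip2 clinear_dbracket_right]]])
qed

lemma sum_lessThan_add: "(\<Sum>j<m + n. f j) = (\<Sum>j<m. f j) + (\<Sum>j<n. f (m + j))" for m n :: nat
  by (induction n) (simp_all add: add.assoc)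

lemma dbracket_words_append:
  "dbracket_words us (vs @ ws) =
     outer (basis (Word vs)) (dbracket_words us ws) 1 + outer 1 (dbracket_words us vs) (basis (Word ws))"
proof -
  have o1: "outer (basis v) (basis p) 1 = basis (v + fst p, snd p)"
    and o2: "outer 1 (basis p) (basis v) = basis (fst p, snd p + v)"
    for v and p :: "'a gen free_monoid \<times> 'a gen free_monoid"
    using outer_basis[of v p 0] outer_basis[of 0 p v] by simp_all
  show ?thesis
    unfolding dbracket_words_def length_append sum_lessThan_add sum.distrib
      clinear_sum[OF clinear_outer_mid] clinear_cscale[OF clinear_outer_mid] o1 o2
    by (subst add.commute, intro arg_cong2[where f = "(+)"] sum.cong refl)
      (simp_all add: nth_append plus_free_monoid_def)
qed

lemma dbracket_derivation: "dbracket a (b * c) = outer b (dbracket a c) 1 + outer 1 (dbracket a b) c"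
proof -
  have 1: "dbracket (basis u) (basis v * basis w) =
      outer (basis v) (dbracket (basis u) (basis w)) 1 + outer 1 (dbracket (basis u) (basis v)) (basis w)"
    for u v w :: "'a gen free_monoid"
    using dbracket_words_append[of "letters u" "letters v" "letters w"]
    by (simp add: basis_mult)
  have 2: "dbracket a (basis v * basis w) =
      outer (basis v) (dbracket a (basis w)) 1 + outer 1 (dbracket a (basis v)) (basis w)"
    for a and v w :: "'a gen free_monoid"
    by (rule clinear_eqI[OF clinear_dbracket_left _ 1])
      (intro clinear_plus clinear_compose[OF clinear_outer_mid clinear_dbracket_left])
  have 3: "dbracket a (b * basis w) =
      outer b (dbracket a (basis w)) 1 + outer 1 (dbracket a b) (basis w)"
    for a b and w :: "'a gen free_monoid"
    by (rule clinear_eqI[OF clinear_compose[OF clinear_dbracket_right clinear_mult_left] _ 2])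
      (intro clinear_plus clinear_outer_left clinear_compose[OF clinear_outer_mid clinear_dbracket_right])
  show ?thesis
    by (rule clinear_eqI[OF clinear_compose[OF clinear_dbracket_right clinear_mult_right] _ 3])
      (intro clinear_plus clinear_outer_right clinear_compose[OF clinear_outer_mid clinear_dbracket_right])
qed

lemma dbracket_letters: "dbracket (letter x) (letter y) = cscale (pairing x y) (tensor2 1 1)"
proof -
  have "(tensor2 1 1 :: 'a free_alg2) = basis (0, 0)"
    by (metis single_one tensor2_basis)
  then have "(tensor2 1 1 :: 'a free_alg2) = basis (Word [], Word [])"
    by (simp only: zero_free_monoid_def)
  then show ?thesis
    by (simp only: letter_def dbracket_basis) (simp add: dbracket_words_def)
qed

theorem symplectic_double_bracket_dbracket: "symplectic_double_bracket dbracket"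
  unfolding symplectic_double_bracket_def
  by (intro conjI allI clinear_dbracket_left clinear_dbracket_right dbracket_antisym
      dbracket_derivation) (simp_all add: dbracket_letters)

theorem symplectic_double_bracket_unique:
  assumes "symplectic_double_bracket D"
  shows "D = dbracket"
proof -
  have lin: "clinear (D a)" "clinear (\<lambda>a. D a b)"
    and anti: "D a b = - flip2 (D b a)"
    and der: "D a (b * c) = outer b (D a c) 1 + outer 1 (D a b) c" for a b c
    using assms unfolding symplectic_double_bracket_def by blast+
  have XX: "D (letter (X i)) (letter (X j)) = 0"
    and SS: "D (letter (Xstar i)) (letter (Xstar j)) = 0"
    and XS: "D (letter (X i)) (letter (Xstar j)) = (if i = j then tensor2 1 1 else 0)" for i j
    using assms unfolding symplectic_double_bracket_def by blast+
  have SX: "D (letter (Xstar i)) (letter (X j)) = (if i = j then - tensor2 1 1 else 0)" for i j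
    by (subst anti) (auto simp: XS flip2_tensor2 clinear_0[OF clinear_flip2])
  have one: "D a 1 = 0" "dbracket a 1 = 0" for a
    using der[of a 1 1] dbracket_derivation[of a 1 1] by (simp_all add: outer_1_1)
  have gen: "D (letter x) (letter y) = dbracket (letter x) (letter y)" for x y
    by (cases x; cases y) (simp_all add: XX SS XS SX dbracket_letters)
  have words: "D a b = dbracket a b" if "\<And>y. D a (letter y) = dbracket a (letter y)" for a b
  proof (rule clinear_eqI[OF lin(1) clinear_dbracket_right])
    fix w
    have "D a (basis (Word ws)) = dbracket a (basis (Word ws))" for ws
      by (induction ws) (simp_all add: basis_Word_Nil one basis_Word_Cons der dbracket_derivation that)
    then show "D a (basis w) = dbracket a (basis w)"
      by (metis free_monoid.collapse)
  qed
  show ?thesis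
  proof (intro HOL.ext)
    fix a b
    show "D a b = dbracket a b"
    proof (rule words)
      fix y
      show "D a (letter y) = dbracket a (letter y)"
        using words[OF gen, of y a] anti[of a "letter y"] dbracket_antisym[of a "letter y"] by simp
    qed
  qed
qed

section \<open>The necklace Lie algebra\<close>

definition commutators :: "'d free_alg set" where
  "commutators = cpm.span {a * b - b * a | a b. True}"

definition loday_bracket :: "'d free_alg \<Rightarrow> 'd free_alg \<Rightarrow> 'd free_alg" where
  "loday_bracket a b = mult2 (dbracket a b)"

definition free_alg_deg :: "nat \<Rightarrow> 'd free_alg set" where
  "free_alg_deg n = {a. \<forall>u\<in>Poly_Mapping.keys a. length (letters u) = n}"

text \<open>The degree \<open>n\<close> part of \<open>A/[A,A]\<close>.\<close>

definition necklace :: "nat \<Rightarrow> 'd free_alg set set" where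
  "necklace n = quotient_carrier (free_alg_deg n) commutators"

definition necklace_bracket :: "'d free_alg set \<Rightarrow> 'd free_alg set \<Rightarrow> 'd free_alg set" where
  "necklace_bracket S T = (\<Union>a\<in>S. \<Union>b\<in>T. loday_bracket a b +o commutators)"

lemma subspace_commutators: "cpm.subspace commutators"
  by (simp add: commutators_def)

lemma commutator_in: "a * b - b * a \<in> commutators"
  unfolding commutators_def by (rule cpm.span_base) blast

lemma clinear_loday_left: "clinear (\<lambda>a. loday_bracket a b)"
  and clinear_loday_right: "clinear (\<lambda>b. loday_bracket a b)"
  unfolding loday_bracket_def
  by (intro clinear_compose[OF clinear_mult2] clinear_dbracket_left clinear_dbracket_right)+

lemma mult2_outer: "mult2 (outer a t c) = mult2 (outer a t 1) * c"
  and mult2_outer': "mult2 (outer a t c) = a * mult2 (outer 1 t c)"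
proof -
  have 1: "mult2 (outer a (basis p) c) = a * basis (fst p + snd p) * c" for p and a c :: "'a free_alg"
    using outer_tensor2[of a "basis (fst p)" "basis (snd p)" c]
    by (simp add: mult2_tensor2 mult.assoc flip: basis_mult)
  show "mult2 (outer a t c) = mult2 (outer a t 1) * c"
    by (rule clinear_eqI[OF clinear_compose[OF clinear_mult2 clinear_outer_mid]
        clinear_compose[OF clinear_mult_left clinear_compose[OF clinear_mult2 clinear_outer_mid]]])
      (simp add: 1)
  show "mult2 (outer a t c) = a * mult2 (outer 1 t c)"
    by (rule clinear_eqI[OF clinear_compose[OF clinear_mult2 clinear_outer_mid]
        clinear_compose[OF clinear_mult_right clinear_compose[OF clinear_mult2 clinear_outer_mid]]])
      (simp add: 1 mult.assoc)
qed

lemma loday_derivation: "loday_bracket a (b * c) = b * loday_bracket a c + loday_bracket a b * c"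
  unfolding loday_bracket_def dbracket_derivation clinear_add[OF clinear_mult2]
  by (simp add: mult2_outer[of 1 _ c] mult2_outer'[of b _ 1] outer_1_1)

lemma mult2_flip2: "mult2 (flip2 t) - mult2 t \<in> commutators"
proof -
  have "mult2 (flip2 t) - mult2 t =
      lin_ext (\<lambda>p. basis (snd p) * basis (fst p) - basis (fst p) * basis (snd p)) t"
    by (rule clinear_eqI[OF clinear_minus'[OF clinear_compose[OF clinear_mult2 clinear_flip2]
            clinear_mult2] clinear_lin_ext]) (simp add: basis_mult)
  also have "\<dots> \<in> commutators"
    unfolding lin_ext_def
    by (intro cpm.subspace_sum[OF subspace_commutators] cpm.subspace_scale[OF subspace_commutators]
        commutator_in)
  finally show ?thesis .
qed

lemma loday_antisym: "loday_bracket a b + loday_bracket b a \<in> commutators"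
  using cpm.subspace_neg[OF subspace_commutators mult2_flip2[of "dbracket b a"]]
    dbracket_antisym[of a b]
  by (simp add: loday_bracket_def clinear_minus[OF clinear_mult2])

lemma loday_commutators_right:
  assumes "c \<in> commutators"
  shows "loday_bracket a c \<in> commutators"
  using assms unfolding commutators_def
proof (induction rule: cpm.span_induct)
  case base
  show ?case
    by (auto simp: cpm.subspace_def clinear_0[OF clinear_loday_right] clinear_add[OF clinear_loday_right]
        clinear_cscale[OF clinear_loday_right] cpm.span_zero cpm.span_add cpm.span_scale)
next
  case (step x)
  then obtain b c where x: "x = b * c - c * b" by blast
  have "loday_bracket a x = (b * loday_bracket a c - loday_bracket a c * b)
      + (loday_bracket a b * c - c * loday_bracket a b)"
    by (simp add: x clinear_diff[OF clinear_loday_right] loday_derivation)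
  also have "\<dots> \<in> commutators"
    by (intro cpm.subspace_add[OF subspace_commutators] commutator_in)
  finally show ?case
    by (simp add: commutators_def)
qed

lemma loday_commutators_left:
  assumes "c \<in> commutators"
  shows "loday_bracket c a \<in> commutators"
  using cpm.subspace_diff[OF subspace_commutators loday_antisym[of a c]
      loday_commutators_right[OF assms, of a]] by simp

lemma necklace_bracket_coset:
  "necklace_bracket (a +o commutators) (b +o commutators) = loday_bracket a b +o commutators"
proof -
  have "loday_bracket a' b' +o commutators = loday_bracket a b +o commutators"
    if "a' \<in> a +o commutators" "b' \<in> b +o commutators" for a' b'
  proof -
    from that obtain c d where cd: "c \<in> commutators" "d \<in> commutators" "a' = a + c" "b' = b + d"
      by (auto simp: elt_set_plus_def)
    have "loday_bracket a' b' - loday_bracket a b = loday_bracket a d + loday_bracket c (b + d)"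
      by (simp add: cd clinear_add[OF clinear_loday_left] clinear_add[OF clinear_loday_right])
    also have "\<dots> \<in> commutators"
      by (intro cpm.subspace_add[OF subspace_commutators] loday_commutators_left
          loday_commutators_right cd)
    finally show ?thesis
      by (simp add: coset_eq_iff[OF subspace_commutators])
  qed
  moreover have "x \<in> x +o commutators" for x :: "'a free_alg"
    using cpm.subspace_0[OF subspace_commutators] by (force simp: elt_set_plus_def)
  ultimately show ?thesis
    unfolding necklace_bracket_def by blast
qed


section \<open>Polynomials and the Poisson bracket\<close>

type_synonym 'd cpoly = "('d gen \<Rightarrow>\<^sub>0 nat) \<Rightarrow>\<^sub>0 complex"

definition var :: "'d gen \<Rightarrow> 'd cpoly" where
  "var x = basis (Poly_Mapping.single x 1)"

definition partial :: "'d gen \<Rightarrow> 'd cpoly \<Rightarrow> 'd cpoly" where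
  "partial x = lin_ext (\<lambda>m. Poly_Mapping.single (m - Poly_Mapping.single x 1)
     (of_nat (Poly_Mapping.lookup m x)))"

definition poisson :: "'d::finite cpoly \<Rightarrow> 'd cpoly \<Rightarrow> 'd cpoly" where
  "poisson f g = (\<Sum>i\<in>UNIV. partial (X i) f * partial (Xstar i) g
     - partial (Xstar i) f * partial (X i) g)"

text \<open>\<open>V\<close> as linear polynomials, and \<open>sp(2d)\<close> as homogeneous quadratic polynomials, with Lie
  bracket \<open>poisson\<close>.\<close>

definition linear_polys :: "'d cpoly set" where
  "linear_polys = cpm.span (range var)"

definition sp :: "'d cpoly set" where
  "sp = {g. \<forall>m\<in>Poly_Mapping.keys g. (\<Sum>x\<in>Poly_Mapping.keys m. Poly_Mapping.lookup m x) = 2}"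

lemma clinear_partial: "clinear (partial x)"
  unfolding partial_def by (rule clinear_lin_ext)

lemma partial_basis:
  "partial x (basis m) = Poly_Mapping.single (m - Poly_Mapping.single x 1) (of_nat (Poly_Mapping.lookup m x))"
  by (simp add: partial_def)

lemma partial_mult: "partial x (p * q) = partial x p * q + p * partial x q"
proof -
  have *: "Poly_Mapping.single (m + m' - Poly_Mapping.single x 1) (of_nat (Poly_Mapping.lookup m x) :: complex)
      = Poly_Mapping.single (m - Poly_Mapping.single x 1 + m') (of_nat (Poly_Mapping.lookup m x))" for m m'
  proof (cases "Poly_Mapping.lookup m x = 0")
    case False
    then have "m + m' - Poly_Mapping.single x 1 = m - Poly_Mapping.single x 1 + m'"
      by (intro poly_mapping_eqI) (auto simp: lookup_add lookup_minus lookup_single when_def)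
    then show ?thesis by simp
  qed simp
  have 1: "partial x (basis m * basis m') = partial x (basis m) * basis m' + basis m * partial x (basis m')"
    for m m'
    using *[of m m'] *[of m' m]
    by (simp add: partial_basis mult_single lookup_add single_add add.commute)
  have 2: "partial x (p * basis m') = partial x p * basis m' + p * partial x (basis m')" for m' p
    by (rule clinear_eqI[OF clinear_compose[OF clinear_partial clinear_mult_left] _ 1])
      (intro clinear_plus clinear_mult_left clinear_compose[OF clinear_mult_left clinear_partial])
  show ?thesis
    by (rule clinear_eqI[OF clinear_compose[OF clinear_partial clinear_mult_right] _ 2])
      (intro clinear_plus clinear_mult_right clinear_compose[OF clinear_mult_right clinear_partial])
qed

lemma partial_var: "partial x (var y) = (if x = y then 1 else 0)"
  by (simp add: var_def partial_basis lookup_single when_def)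

lemma clinear_poisson_left: "clinear (\<lambda>f. poisson f g)"
  and clinear_poisson_right: "clinear (poisson f)"
  unfolding poisson_def
  by (intro clinear_sum' clinear_minus' clinear_compose[OF clinear_mult_left clinear_partial]
      clinear_compose[OF clinear_mult_right clinear_partial])+

lemma poisson_antisym: "poisson f g = - poisson g f"
  by (simp add: poisson_def sum_negf[symmetric] mult.commute)

lemma poisson_leibniz: "poisson f (g * h) = g * poisson f h + poisson f g * h"
  unfolding poisson_def sum_distrib_left sum_distrib_right sum.distrib[symmetric] partial_mult
  by (intro sum.cong refl) (simp add: algebra_simps)

lemma poisson_var: "poisson (var x) (var y) = Poly_Mapping.single 0 (pairing x y)"
proof -
  have 1: "(\<Sum>i\<in>UNIV. (if i = a then 1 else 0) * (if i = b then 1 else 0)) = (if a = b then 1 else (0 :: 'a cpoly))"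
    for a b :: 'a
    by (simp add: if_distrib[of "\<lambda>c. c * _"] cong: if_cong)
  have 2: "Poly_Mapping.single 0 (- 1) = (- 1 :: 'a cpoly)"
    by (metis single_uminus single_one)
  show ?thesis
    by (cases x; cases y) (simp_all add: poisson_def partial_var sum_negf 1 2)
qed

subsection \<open>The identification of the degree two part with \<open>sp(2d)\<close>\<close>

definition abelianize :: "'d free_alg \<Rightarrow> 'd cpoly" where
  "abelianize = lin_ext (\<lambda>u. prod_list (map var (letters u)))"

text \<open>\<open>abelianize\<close> is constant on cosets of \<open>[A,A]\<close>; this is the induced map on \<open>A/[A,A]\<close>.\<close>

definition necklace_to_poly :: "'d free_alg set \<Rightarrow> 'd cpoly" where
  "necklace_to_poly S = the_elem (abelianize ` S)"

lemma clinear_abelianize: "clinear abelianize"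
  unfolding abelianize_def by (rule clinear_lin_ext)

lemma abelianize_basis: "abelianize (basis u) = prod_list (map var (letters u))"
  by (simp add: abelianize_def)

lemma abelianize_mult: "abelianize (a * b) = abelianize a * abelianize b"
proof -
  have "abelianize (basis u * b) = abelianize (basis u) * abelianize b" for u
    by (rule clinear_eqI[OF clinear_compose[OF clinear_abelianize clinear_mult_right]
        clinear_compose[OF clinear_mult_right clinear_abelianize]])
      (simp add: basis_mult abelianize_basis)
  then show ?thesis
    by (rule clinear_eqI[OF clinear_compose[OF clinear_abelianize clinear_mult_left]
        clinear_compose[OF clinear_mult_left clinear_abelianize]])
qed

lemma abelianize_letter: "abelianize (letter x) = var x"
  by (simp add: letter_def abelianize_basis)

lemma abelianize_commutators:
  assumes "c \<in> commutators"
  shows "abelianize c = 0"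
  using assms unfolding commutators_def
proof (induction rule: cpm.span_induct)
  case base
  show ?case
    by (auto simp: cpm.subspace_def clinear_0[OF clinear_abelianize] clinear_add[OF clinear_abelianize]
        clinear_cscale[OF clinear_abelianize])
next
  case (step x)
  then show ?case
    by (auto simp: clinear_diff[OF clinear_abelianize] abelianize_mult mult.commute)
qed

lemma necklace_to_poly_coset: "necklace_to_poly (a +o commutators) = abelianize a"
proof -
  have "abelianize ` (a +o commutators) = {abelianize a}"
    using cpm.subspace_0[OF subspace_commutators]
    by (auto simp: elt_set_plus_def clinear_add[OF clinear_abelianize] abelianize_commutators
        intro!: image_eqI[of _ _ a])
  then show ?thesis
    by (simp add: necklace_to_poly_def)
qed

lemma abelianize_loday: "abelianize (loday_bracket a b) = poisson (abelianize a) (abelianize b)"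
proof -
  have lin: "clinear (\<lambda>b. abelianize (loday_bracket a b))"
      "clinear (\<lambda>b. poisson (abelianize a) (abelianize b))" for a :: "'a free_alg"
    by (intro clinear_compose[OF clinear_abelianize clinear_loday_right]
        clinear_compose[OF clinear_poisson_right clinear_abelianize])+
  have one: "loday_bracket a 1 = 0" "poisson p 1 = 0" for a :: "'a free_alg" and p :: "'a cpoly"
    using loday_derivation[of a 1 1] poisson_leibniz[of p 1 1] by simp_all
  have ab1: "abelianize 1 = 1"
    using abelianize_basis[of 0] by simp
  have words: "abelianize (loday_bracket a b) = poisson (abelianize a) (abelianize b)"
    if *: "\<And>y. abelianize (loday_bracket a (letter y)) = poisson (abelianize a) (var y)"
    for a b :: "'a free_alg"
  proof (rule clinear_eqI[OF lin])
    fix w :: "'a gen free_monoid"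
    have "abelianize (loday_bracket a (basis (Word ws))) = poisson (abelianize a) (abelianize (basis (Word ws)))" for ws
      by (induction ws)
        (simp_all add: basis_Word_Nil one ab1 basis_Word_Cons loday_derivation poisson_leibniz
          abelianize_mult abelianize_letter * clinear_add[OF clinear_abelianize] clinear_0[OF clinear_abelianize])
    then show "abelianize (loday_bracket a (basis w)) = poisson (abelianize a) (abelianize (basis w))"
      by (metis free_monoid.collapse)
  qed
  have letters: "abelianize (loday_bracket (letter x) (letter y)) = poisson (abelianize (letter x)) (var y)"
    for x y :: "'a gen"
    by (simp add: loday_bracket_def dbracket_letters clinear_cscale[OF clinear_mult2] mult2_tensor2
        clinear_cscale[OF clinear_abelianize] ab1 abelianize_letter poisson_var)
      (simp add: cscale_conv_mult)
  have anti: "abelianize (loday_bracket a b) = - abelianize (loday_bracket b a)" for a b :: "'a free_alg"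
    using abelianize_commutators[OF loday_antisym[of a b]]
    by (simp add: clinear_add[OF clinear_abelianize] eq_neg_iff_add_eq_0)
  show ?thesis
  proof (rule words)
    fix y
    show "abelianize (loday_bracket a (letter y)) = poisson (abelianize a) (var y)"
      using words[OF letters, of y a] anti[of a "letter y"] poisson_antisym[of "abelianize a" "var y"]
      by (simp add: abelianize_letter)
  qed
qed

lemma necklace_to_poly_bracket:
  assumes "S \<in> necklace m" "T \<in> necklace n"
  shows "necklace_to_poly (necklace_bracket S T) = poisson (necklace_to_poly S) (necklace_to_poly T)"
  using assms
  by (auto simp: necklace_def quotient_carrier_def necklace_bracket_coset necklace_to_poly_coset
      abelianize_loday)

lemma var_mult: "var x * var y = basis (Poly_Mapping.single x 1 + Poly_Mapping.single y 1)"
  by (simp add: var_def mult_single)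

lemma subspace_sp: "cpm.subspace sp"
  unfolding cpm.subspace_def sp_def
  using Poly_Mapping.keys_add by (auto simp: in_keys_iff lookup_add)

lemma monomial_degree_two_iff:
  fixes m :: "'d::finite gen \<Rightarrow>\<^sub>0 nat"
  shows "(\<Sum>x\<in>Poly_Mapping.keys m. Poly_Mapping.lookup m x) = 2 \<longleftrightarrow>
    (\<exists>x y. m = Poly_Mapping.single x 1 + Poly_Mapping.single y 1)"
proof -
  define deg where "deg m = (\<Sum>x\<in>UNIV. Poly_Mapping.lookup m x)" for m :: "'d gen \<Rightarrow>\<^sub>0 nat"
  have deg: "(\<Sum>x\<in>Poly_Mapping.keys m. Poly_Mapping.lookup m x) = deg m" for m :: "'d gen \<Rightarrow>\<^sub>0 nat"
    unfolding deg_def by (rule sum.mono_neutral_left) (auto simp: in_keys_iff)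
  have add: "deg (p + q) = deg p + deg q" for p q
    by (simp add: deg_def lookup_add sum.distrib)
  have single: "deg (Poly_Mapping.single x 1) = 1" for x
    by (simp add: deg_def lookup_single when_def)
  have split: "\<exists>x m'. m = Poly_Mapping.single x 1 + m' \<and> deg m' = k" if "deg m = Suc k" for m k
  proof -
    from that obtain x where x: "Poly_Mapping.lookup m x \<noteq> 0"
      unfolding deg_def by (auto dest!: sum_SucD)
    have m: "m = Poly_Mapping.single x 1 + (m - Poly_Mapping.single x 1)"
      using x by (intro poly_mapping_eqI) (auto simp: lookup_add lookup_minus lookup_single when_def)
    have "deg m = deg (Poly_Mapping.single x 1 + (m - Poly_Mapping.single x 1))"
      by (simp only: m[symmetric])
    also have "\<dots> = 1 + deg (m - Poly_Mapping.single x 1)"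
      by (simp only: add single)
    finally have "deg (m - Poly_Mapping.single x 1) = k"
      using that by simp
    with m show ?thesis by blast
  qed
  have zero: "m = 0" if "deg m = 0" for m
    using that by (intro poly_mapping_eqI) (simp add: deg_def)
  show ?thesis
    unfolding deg
  proof
    assume "deg m = 2"
    then obtain x m' where m: "m = Poly_Mapping.single x 1 + m'" "deg m' = Suc 0"
      using split[of m "Suc 0"] by (auto simp: numeral_2_eq_2)
    then obtain y m'' where m': "m' = Poly_Mapping.single y 1 + m''" "deg m'' = 0"
      using split[of m' 0] by blast
    have "m = Poly_Mapping.single x 1 + Poly_Mapping.single y 1"
      using m(1) m'(1) zero[OF m'(2)] by simp
    then show "\<exists>x y. m = Poly_Mapping.single x 1 + Poly_Mapping.single y 1"
      by blast
  qed (auto simp: add single simp del: One_nat_def)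
qed

lemma word_two_commute:
  assumes "Poly_Mapping.single x 1 + Poly_Mapping.single y 1 =
    Poly_Mapping.single x' (1 :: nat) + Poly_Mapping.single y' 1"
  shows "x = x' \<and> y = y' \<or> x = y' \<and> y = x'"
proof -
  have *: "(if x = z then 1 else 0) + (if y = z then 1 else 0) =
      (if x' = z then 1 else 0) + (if y' = z then 1 else (0 :: nat))" for z
    using arg_cong[OF assms, of "\<lambda>m. Poly_Mapping.lookup m z"]
    unfolding lookup_add lookup_single when_def .
  have x: "x' = x \<or> y' = x"
    using *[of x] by (rule contrapos_pp) simp
  have y: "x' = y \<or> y' = y"
    using *[of y] by (rule contrapos_pp) simp
  show ?thesis
  proof (cases "x = y")
    case True
    have "x' = x \<and> y' = x"
      using *[of x] unfolding True[symmetric] by (rule contrapos_pp) auto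
    with True show ?thesis by simp
  next
    case False
    with x y show ?thesis by blast
  qed
qed

theorem bij_betw_necklace_to_poly:
  "bij_betw necklace_to_poly (necklace 2 :: 'd::finite free_alg set set) sp"
proof -
  define \<sigma> :: "('d gen \<Rightarrow>\<^sub>0 nat) \<Rightarrow> 'd gen free_monoid" where
    "\<sigma> m = (SOME u. \<exists>x y. u = Word [x, y] \<and> m = Poly_Mapping.single x 1 + Poly_Mapping.single y 1)" for m
  have \<sigma>: "\<exists>x' y'. \<sigma> (Poly_Mapping.single x 1 + Poly_Mapping.single y 1) = Word [x', y'] \<and>
      Poly_Mapping.single x 1 + Poly_Mapping.single y 1 = Poly_Mapping.single x' (1 :: nat) + Poly_Mapping.single y' 1"
    for x y
    unfolding \<sigma>_def by (rule someI_ex) blast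
  define s where "s = lin_ext (\<lambda>m. basis (\<sigma> m))"
  have lin_s: "clinear s"
    unfolding s_def by (rule clinear_lin_ext)
  have two: "\<exists>x y. u = Word [x, y]" if "length (letters u) = 2" for u :: "'d gen free_monoid"
    using that by (cases u) (auto simp: numeral_2_eq_2 length_Suc_conv)
  have s_basis: "s (basis m) = basis (\<sigma> m)" for m
    by (simp add: s_def)
  have swap: "basis (Word [x, y]) - basis (Word [y, x]) \<in> commutators" for x y :: "'d gen"
    using commutator_in[of "basis (Word [x])" "basis (Word [y])"]
    by (simp add: basis_mult plus_free_monoid_def)
  have word: "basis u - s (abelianize (basis u)) \<in> commutators" if len: "length (letters u) = 2" for u
  proof -
    obtain x y where u: "u = Word [x, y]"
      using two[OF len] by blast
    obtain x' y' where xy: "\<sigma> (Poly_Mapping.single x 1 + Poly_Mapping.single y 1) = Word [x', y']"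
      "Poly_Mapping.single x 1 + Poly_Mapping.single y 1 = Poly_Mapping.single x' (1 :: nat) + Poly_Mapping.single y' 1"
      using \<sigma>[of x y] by blast
    have "x = x' \<and> y = y' \<or> x = y' \<and> y = x'"
      by (rule word_two_commute[OF xy(2)])
    then show ?thesis
      using xy(1) swap[of x y] cpm.subspace_0[OF subspace_commutators]
      by (auto simp: u abelianize_basis var_mult s_basis)
  qed
  have retract: "a - s (abelianize a) \<in> commutators" if "a \<in> free_alg_deg 2" for a
  proof -
    have "a - s (abelianize a) = (\<Sum>u\<in>Poly_Mapping.keys a. cscale (Poly_Mapping.lookup a u)
        (basis u - s (abelianize (basis u))))"
      using clinear_eq_lin_ext[OF clinear_minus'[OF clinear_id clinear_compose[OF lin_s clinear_abelianize]], of a]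
      by (simp only: lin_ext_def)
    also have "\<dots> \<in> commutators"
      using that unfolding free_alg_deg_def
      by (intro cpm.subspace_sum[OF subspace_commutators] cpm.subspace_scale[OF subspace_commutators] word) auto
    finally show ?thesis .
  qed
  have into: "abelianize a \<in> sp" if deg: "a \<in> free_alg_deg 2" for a :: "'d free_alg"
    unfolding abelianize_def lin_ext_def
  proof (intro cpm.subspace_sum[OF subspace_sp] cpm.subspace_scale[OF subspace_sp])
    fix u assume "u \<in> Poly_Mapping.keys a"
    then obtain x y where u: "u = Word [x, y]"
      using deg two unfolding free_alg_deg_def by blast
    have "basis (Poly_Mapping.single x 1 + Poly_Mapping.single y 1) \<in> sp"
      unfolding sp_def monomial_degree_two_iff by auto
    then show "prod_list (map var (letters u)) \<in> sp"
      by (simp add: u var_mult)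
  qed
  have surj: "s p \<in> free_alg_deg 2 \<and> abelianize (s p) = p" if p: "p \<in> sp" for p
  proof
    have \<sigma>': "\<exists>x y. \<sigma> m = Word [x, y] \<and> m = Poly_Mapping.single x 1 + Poly_Mapping.single y 1"
      if mem: "m \<in> Poly_Mapping.keys p" for m
    proof -
      obtain x y where m: "m = Poly_Mapping.single x 1 + Poly_Mapping.single y 1"
        using p mem unfolding sp_def mem_Collect_eq monomial_degree_two_iff by meson
      show ?thesis
        using \<sigma>[of x y] unfolding m[symmetric] by meson
    qed
    show "s p \<in> free_alg_deg 2"
      unfolding free_alg_deg_def
    proof safe
      fix u assume "u \<in> Poly_Mapping.keys (s p)"
      then have u: "Poly_Mapping.lookup (s p) u \<noteq> 0"
        by (simp add: in_keys_iff)
      have lk: "Poly_Mapping.lookup (s p) u =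
          (\<Sum>m\<in>Poly_Mapping.keys p. Poly_Mapping.lookup p m * Poly_Mapping.lookup (basis (\<sigma> m)) u)"
        by (simp only: s_def lin_ext_def lookup_sum lookup_cscale)
      have "\<exists>m\<in>Poly_Mapping.keys p. \<sigma> m = u"
      proof (rule ccontr)
        assume "\<not> ?thesis"
        then have "Poly_Mapping.lookup (s p) u = 0"
          unfolding lk by (intro sum.neutral) (auto simp: lookup_single_not_eq)
        with u show False by simp
      qed
      then obtain m where m: "m \<in> Poly_Mapping.keys p" "\<sigma> m = u" by blast
      obtain x y where "\<sigma> m = Word [x, y]"
        using \<sigma>'[OF m(1)] by (elim exE conjE)
      with m(2) show "length (letters u) = 2" by auto
    qed
    have "abelianize (s p) = (\<Sum>m\<in>Poly_Mapping.keys p. cscale (Poly_Mapping.lookup p m) (abelianize (basis (\<sigma> m))))"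
      unfolding s_def lin_ext_def clinear_sum[OF clinear_abelianize] clinear_cscale[OF clinear_abelianize] ..
    also have "\<dots> = (\<Sum>m\<in>Poly_Mapping.keys p. cscale (Poly_Mapping.lookup p m) (basis m))"
    proof (intro sum.cong refl)
      fix m assume "m \<in> Poly_Mapping.keys p"
      from \<sigma>'[OF this] obtain x y
        where xy: "\<sigma> m = Word [x, y]" "Poly_Mapping.single x 1 + Poly_Mapping.single y 1 = m"
        by (elim exE conjE) (rule that, assumption, rule sym)
      have "abelianize (basis (\<sigma> m)) = var x * var y"
        by (simp only: xy(1) abelianize_basis) simp
      then show "cscale (Poly_Mapping.lookup p m) (abelianize (basis (\<sigma> m))) =
          cscale (Poly_Mapping.lookup p m) (basis m)"
        by (simp only: var_mult xy(2))
    qed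
    finally show "abelianize (s p) = p"
      by (simp only: basis_expansion)
  qed
  have inj: "a - b \<in> commutators"
    if "a \<in> free_alg_deg 2" "b \<in> free_alg_deg 2" "abelianize a = abelianize b" for a b :: "'d free_alg"
    using cpm.subspace_diff[OF subspace_commutators retract[OF that(1)] retract[OF that(2)]] that(3)
    by simp
  show ?thesis
  proof (rule bij_betw_imageI)
    show "inj_on necklace_to_poly (necklace 2 :: 'd free_alg set set)"
      unfolding necklace_def quotient_carrier_def
      by (intro inj_onI, elim imageE)
        (simp add: necklace_to_poly_coset coset_eq_iff[OF subspace_commutators] inj)
    have "necklace_to_poly ` necklace 2 = abelianize ` (free_alg_deg 2 :: 'd free_alg set)"
      by (simp add: necklace_def quotient_carrier_def image_image necklace_to_poly_coset)
    also have "\<dots> = sp"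
    proof
      show "abelianize ` free_alg_deg 2 \<subseteq> (sp :: 'd cpoly set)"
        using into by (rule image_subsetI)
      show "sp \<subseteq> abelianize ` (free_alg_deg 2 :: 'd free_alg set)"
      proof
        fix p :: "'d cpoly"
        assume "p \<in> sp"
        from surj[OF this] show "p \<in> abelianize ` (free_alg_deg 2 :: 'd free_alg set)"
          by (intro image_eqI[of _ _ "s p"]) simp_all
      qed
    qed
    finally show "necklace_to_poly ` (necklace 2 :: 'd free_alg set set) = sp" .
  qed
qed

section \<open>Tensor powers of \<open>V\<close> and cyclic tensors\<close>

text \<open>
  The letters form a basis of \<open>V\<close>, so the words of length \<open>n\<close> in the letters form a basis of
  \<open>V\<^bsup>\<otimes>n\<^esup>\<close>.
\<close>

type_synonym 'd tensors = "'d gen list \<Rightarrow>\<^sub>0 complex"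

definition tensor_power :: "nat \<Rightarrow> 'd tensors set" where
  "tensor_power n = {t. \<forall>w\<in>Poly_Mapping.keys t. length w = n}"

definition lin_coeff :: "'d cpoly \<Rightarrow> 'd gen \<Rightarrow> complex" where
  "lin_coeff v x = Poly_Mapping.lookup v (Poly_Mapping.single x 1)"

definition pure_tensor :: "'d::finite cpoly list \<Rightarrow> 'd tensors" where
  "pure_tensor vs = Abs_poly_mapping (\<lambda>w.
     if length w = length vs then \<Prod>i<length vs. lin_coeff (vs ! i) (w ! i) else 0)"

text \<open>Defined on the basis; \<open>tensor_act_pure_tensor\<close> below gives the formula for all pure tensors.\<close>

definition tensor_act :: "'d::finite cpoly \<Rightarrow> 'd tensors \<Rightarrow> 'd tensors" where
  "tensor_act g = lin_ext (\<lambda>w. \<Sum>i<length w. pure_tensor ((map var w)[i := poisson g (var (w ! i))]))"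

definition cyclic_relations :: "nat \<Rightarrow> 'd::finite tensors set" where
  "cyclic_relations n = cpm.span
     {pure_tensor vs - pure_tensor (rotate1 vs) | vs. length vs = n \<and> set vs \<subseteq> linear_polys}"

lemma lookup_pure_tensor:
  fixes vs :: "'d::finite cpoly list"
  shows "Poly_Mapping.lookup (pure_tensor vs) w =
    (if length w = length vs then \<Prod>i<length vs. lin_coeff (vs ! i) (w ! i) else 0)"
proof -
  have "finite {w :: 'd gen list. length w = length vs}"
    using finite_lists_length_eq[of "UNIV :: 'd gen set" "length vs"] by simp
  then have "finite {w. (if length w = length vs then \<Prod>i<length vs. lin_coeff (vs ! i) (w ! i) else 0) \<noteq> 0}"
    by (rule rev_finite_subset) (auto split: if_splits)
  then show ?thesis
    by (simp add: pure_tensor_def)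
qed

lemma lin_coeff_add: "lin_coeff (u + v) x = lin_coeff u x + lin_coeff v x"
  and lin_coeff_cscale: "lin_coeff (cscale c u) x = c * lin_coeff u x"
  by (simp_all add: lin_coeff_def lookup_add)

lemma lin_coeff_var: "lin_coeff (var x) y = (if x = y then 1 else 0)"
proof -
  have "Poly_Mapping.single x (1 :: nat) = Poly_Mapping.single y 1 \<longleftrightarrow> x = y"
    by (metis lookup_single_eq lookup_single_not_eq one_neq_zero)
  then show ?thesis
    by (simp add: lin_coeff_def var_def lookup_single when_def)
qed

lemma pure_tensor_var: "pure_tensor (map var w) = basis w"
proof (rule poly_mapping_eqI)
  fix w'
  have "(\<Prod>i<length w. if w ! i = w' ! i then 1 else (0 :: complex)) = (if w = w' then 1 else 0)"
    if "length w' = length w"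
    using that by (auto simp: list_eq_iff_nth_eq)
  then show "Poly_Mapping.lookup (pure_tensor (map var w)) w' = Poly_Mapping.lookup (basis w) w'"
    by (auto simp: lookup_pure_tensor lin_coeff_var lookup_single when_def)
qed

subsection \<open>Universal property of \<open>pure_tensor\<close>\<close>

definition multilinear :: "nat \<Rightarrow> ('d cpoly list \<Rightarrow> ('k \<Rightarrow>\<^sub>0 complex)) \<Rightarrow> bool" where
  "multilinear n F \<longleftrightarrow> (\<forall>vs i. length vs = n \<and> i < n \<longrightarrow> clinear (\<lambda>u. F (vs[i := u])))"

lemma multilinear_eqI:
  assumes F: "multilinear n F" and G: "multilinear n G"
    and eq: "\<And>w. length w = n \<Longrightarrow> F (map var w) = G (map var w)"
    and vs: "length vs = n" "set vs \<subseteq> linear_polys"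
  shows "F vs = G vs"
proof -
  have "F vs = G vs"
    if "k \<le> n" "length vs = n" "set vs \<subseteq> linear_polys" "set (drop k vs) \<subseteq> range var" for k vs
    using that
  proof (induction k arbitrary: vs)
    case 0
    then have "map var (map (inv_into UNIV var) vs) = vs"
      by (auto simp: subset_iff map_idI f_inv_into_f)
    with eq[of "map (inv_into UNIV var) vs"] 0 show ?case by simp
  next
    case (Suc k)
    have lin: "clinear (\<lambda>u. F (vs[k := u]))" "clinear (\<lambda>u. G (vs[k := u]))"
      using F G Suc.prems unfolding multilinear_def by auto
    have "vs ! k \<in> cpm.span (range var)"
      using Suc.prems by (auto simp: linear_polys_def)
    then have "F (vs[k := vs ! k]) = G (vs[k := vs ! k])"
    proof (induction rule: cpm.span_induct)
      case base
      show ?case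
        by (auto simp: cpm.subspace_def clinear_0[OF lin(1)] clinear_0[OF lin(2)] clinear_add[OF lin(1)]
            clinear_add[OF lin(2)] clinear_cscale[OF lin(1)] clinear_cscale[OF lin(2)])
    next
      case (step x)
      have "x \<in> linear_polys"
        using step by (auto simp: linear_polys_def intro: cpm.span_base)
      moreover have "drop k (vs[k := x]) = x # drop (Suc k) vs"
        using Suc.prems by (simp add: drop_update_swap Cons_nth_drop_Suc[symmetric])
      ultimately show ?case
        using Suc.prems step set_update_subset_insert[of vs k x]
        by (intro Suc.IH) auto
    qed
    then show ?case by simp
  qed
  from this[of n] vs show ?thesis by simp
qed

lemma multilinear_pure_tensor: "multilinear n pure_tensor"
  unfolding multilinear_def
proof (intro allI impI clinearI)
  fix vs :: "'a cpoly list" and i u v c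
  assume i: "length vs = n \<and> i < n"
  have *: "Poly_Mapping.lookup (pure_tensor (vs[i := u])) w = (if length w = n
      then lin_coeff u (w ! i) * (\<Prod>j\<in>{..<n} - {i}. lin_coeff (vs ! j) (w ! j)) else 0)" for u w
    using i by (simp add: lookup_pure_tensor prod.remove[of _ i])
  show "pure_tensor (vs[i := u + v]) = pure_tensor (vs[i := u]) + pure_tensor (vs[i := v])"
    by (rule poly_mapping_eqI) (simp add: * lookup_add lin_coeff_add algebra_simps)
  show "pure_tensor (vs[i := cscale c u]) = cscale c (pure_tensor (vs[i := u]))"
    by (rule poly_mapping_eqI) (simp add: * lin_coeff_cscale)
qed

theorem tensor_power_universal:
  assumes "multilinear n F" "length vs = n" "set vs \<subseteq> linear_polys"
  shows "F vs = lin_ext (\<lambda>w. F (map var w)) (pure_tensor vs)"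
proof (rule multilinear_eqI[OF assms(1) _ _ assms(2,3)])
  show "multilinear n (\<lambda>vs. lin_ext (\<lambda>w. F (map var w)) (pure_tensor vs))"
    using multilinear_pure_tensor[of n] clinear_compose[OF clinear_lin_ext]
    unfolding multilinear_def by blast
qed (simp add: pure_tensor_var)

theorem tensor_act_pure_tensor:
  assumes "set vs \<subseteq> linear_polys"
  shows "tensor_act g (pure_tensor vs) = (\<Sum>i<length vs. pure_tensor (vs[i := poisson g (vs ! i)]))"
proof -
  define F where "F vs = (\<Sum>i<length vs. pure_tensor (vs[i := poisson g (vs ! i)]))" for vs
  have "clinear (\<lambda>u. pure_tensor (vs[k := u, i := poisson g (vs[k := u] ! i)]))"
    if "k < length vs" "i < length vs" for vs k i
  proof (cases "i = k")
    case True
    have "clinear (\<lambda>u. pure_tensor (vs[i := u]))"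
      using that multilinear_pure_tensor unfolding multilinear_def by blast
    from clinear_compose[OF this clinear_poisson_right] True that show ?thesis
      by simp
  next
    case False
    have "clinear (\<lambda>u. pure_tensor ((vs[i := poisson g (vs ! i)])[k := u]))"
      using that multilinear_pure_tensor[of "length vs", unfolded multilinear_def, rule_format,
          of "vs[i := poisson g (vs ! i)]" k] by simp
    with False show ?thesis
      by (simp add: list_update_swap)
  qed
  then have "multilinear (length vs) F"
    unfolding multilinear_def F_def by (auto intro!: clinear_sum')
  note * = tensor_power_universal[OF this refl assms]
  have words: "F (map var w) = (\<Sum>i<length w. pure_tensor ((map var w)[i := poisson g (var (w ! i))]))" for w
    unfolding F_def by (intro sum.cong) simp_all
  show ?thesis
    using *[unfolded words] unfolding tensor_act_def F_def by (rule sym)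
qed


section \<open>Modules over \<open>sp(2d)\<close>\<close>

definition complex_field :: "complex ring" where
  "complex_field = \<lparr>carrier = UNIV, mult = (*), one = 1, zero = 0, add = (+)\<rparr>"

record ('g, 'm) lie_rep = "(complex, 'm) module" +
  act :: "'g \<Rightarrow> 'm \<Rightarrow> 'm"

definition sp_module :: "('d::finite cpoly, 'm) lie_rep \<Rightarrow> bool" where
  "sp_module M \<longleftrightarrow> Module.module complex_field M \<and>
     (\<forall>g\<in>sp. \<forall>m\<in>carrier M. act M g m \<in> carrier M) \<and>
     (\<forall>g\<in>sp. \<forall>m\<in>carrier M. \<forall>m'\<in>carrier M. act M g (m \<oplus>\<^bsub>M\<^esub> m') = act M g m \<oplus>\<^bsub>M\<^esub> act M g m') \<and>
     (\<forall>g\<in>sp. \<forall>c. \<forall>m\<in>carrier M. act M g (c \<odot>\<^bsub>M\<^esub> m) = c \<odot>\<^bsub>M\<^esub> act M g m) \<and>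
     (\<forall>g\<in>sp. \<forall>h\<in>sp. \<forall>m\<in>carrier M. act M (g + h) m = act M g m \<oplus>\<^bsub>M\<^esub> act M h m) \<and>
     (\<forall>g\<in>sp. \<forall>c. \<forall>m\<in>carrier M. act M (cscale c g) m = c \<odot>\<^bsub>M\<^esub> act M g m) \<and>
     (\<forall>g\<in>sp. \<forall>h\<in>sp. \<forall>m\<in>carrier M.
        act M (poisson g h) m = act M g (act M h m) \<ominus>\<^bsub>M\<^esub> act M h (act M g m))"

definition sp_module_iso ::
  "('d::finite cpoly, 'm) lie_rep \<Rightarrow> ('d cpoly, 'n) lie_rep \<Rightarrow> ('m \<Rightarrow> 'n) \<Rightarrow> bool" where
  "sp_module_iso M N \<Phi> \<longleftrightarrow> sp_module M \<and> sp_module N \<and> bij_betw \<Phi> (carrier M) (carrier N) \<and>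
     (\<forall>m\<in>carrier M. \<forall>m'\<in>carrier M. \<Phi> (m \<oplus>\<^bsub>M\<^esub> m') = \<Phi> m \<oplus>\<^bsub>N\<^esub> \<Phi> m') \<and>
     (\<forall>c. \<forall>m\<in>carrier M. \<Phi> (c \<odot>\<^bsub>M\<^esub> m) = c \<odot>\<^bsub>N\<^esub> \<Phi> m) \<and>
     (\<forall>g\<in>sp. \<forall>m\<in>carrier M. \<Phi> (act M g m) = act N g (\<Phi> m))"

text \<open>
  The vector space \<open>U/W\<close> of cosets with an action \<open>\<rho>\<close> on cosets. The fields \<open>mult\<close> and \<open>one\<close>, which
  \<open>module\<close> inherits from \<open>ring\<close>, play no role in the notion of a module.
\<close>

definition quotient_rep ::
  "('k \<Rightarrow>\<^sub>0 complex) set \<Rightarrow> ('k \<Rightarrow>\<^sub>0 complex) set \<Rightarrow>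
   ('g \<Rightarrow> ('k \<Rightarrow>\<^sub>0 complex) set \<Rightarrow> ('k \<Rightarrow>\<^sub>0 complex) set) \<Rightarrow> ('g, ('k \<Rightarrow>\<^sub>0 complex) set) lie_rep" where
  "quotient_rep U W \<rho> =
     \<lparr>carrier = quotient_carrier U W, mult = undefined, one = undefined,
      zero = W, add = (+), smult = (\<lambda>c. quotient_map W (cscale c)), act = \<rho>\<rparr>"

definition cyclic_tensors :: "nat \<Rightarrow> ('d::finite cpoly, 'd tensors set) lie_rep" where
  "cyclic_tensors n = quotient_rep (tensor_power n) (cyclic_relations n)
     (\<lambda>g. quotient_map (cyclic_relations n) (tensor_act g))"

text \<open>\<open>\<nn>\<^sub>n\<close>, with \<open>g\<close> acting as the bracket with the element of \<open>\<nn>\<^sub>2\<close> identified with \<open>g\<close>.\<close>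

definition necklace_rep :: "nat \<Rightarrow> ('d::finite cpoly, 'd free_alg set) lie_rep" where
  "necklace_rep n = quotient_rep (free_alg_deg n) commutators
     (\<lambda>g. necklace_bracket (inv_into (necklace 2) necklace_to_poly g))"

definition linear_to_alg :: "'d::finite cpoly \<Rightarrow> 'd free_alg" where
  "linear_to_alg v = (\<Sum>x\<in>UNIV. cscale (lin_coeff v x) (letter x))"

lemma linear_to_alg_var: "linear_to_alg (var x) = letter x"
proof -
  have "linear_to_alg (var x) = (\<Sum>y\<in>UNIV. if x = y then letter y else 0)"
    unfolding linear_to_alg_def by (intro sum.cong) (simp_all add: lin_coeff_var)
  then show ?thesis by simp
qed

end

theory Submission
  imports Defs
begin

text \<open>
  Words give a linear bijection \<open>\<theta>\<close> from tensors to the free algebra. It maps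
  \<open>v\<^sub>1 \<otimes> \<dots> \<otimes> v\<^sub>n - v\<^sub>2 \<otimes> \<dots> \<otimes> v\<^sub>n \<otimes> v\<^sub>1\<close> to a commutator, and conversely the degree \<open>n\<close> part of a
  commutator of words is a difference \<open>w - rotate k w\<close>, so \<open>C\<^sub>n\<close> is the preimage of \<open>[A,A]\<close> in
  degree \<open>n\<close>. For \<open>a\<close> of degree two, \<open>{a, -}\<^sub>L\<close> is a derivation of \<open>A\<close> which on letters agrees with
  the action of the quadratic polynomial of \<open>a\<close> on \<open>V\<close>; hence \<open>\<theta>\<close> intertwines the two actions even
  before passing to quotients. In particular the module axioms on both sides follow from the
  Jacobi identity for \<open>{-, -}\<^sub>L\<close>, which for two elements of degree two need only be checked on letters.
\<close>

section \<open>Linear maps tested on supports and spanning sets\<close>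

lemma clinear_in_subspace:
  assumes "clinear F" "cpm.subspace W" "\<And>k. k \<in> Poly_Mapping.keys p \<Longrightarrow> F (basis k) \<in> W"
  shows "F p \<in> W"
  unfolding clinear_eq_lin_ext[OF assms(1), of p] lin_ext_def
  by (intro cpm.subspace_sum[OF assms(2)] cpm.subspace_scale[OF assms(2)] assms(3))

lemma clinear_eq_on_keys:
  assumes "clinear F" "clinear G" "\<And>k. k \<in> Poly_Mapping.keys p \<Longrightarrow> F (basis k) = G (basis k)"
  shows "F p = G p"
  unfolding clinear_eq_lin_ext[OF assms(1), of p] clinear_eq_lin_ext[OF assms(2), of p] lin_ext_def
  using assms(3) by simp

lemma clinear_span_in_subspace:
  assumes "clinear F" "cpm.subspace W" "\<And>x. x \<in> S \<Longrightarrow> F x \<in> W" "x \<in> cpm.span S"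
  shows "F x \<in> W"
  using assms(4)
proof (induction rule: cpm.span_induct)
  case base
  show ?case
    using cpm.subspace_0[OF assms(2)] cpm.subspace_add[OF assms(2)] cpm.subspace_scale[OF assms(2)]
    by (auto simp: cpm.subspace_def clinear_0[OF assms(1)] clinear_add[OF assms(1)]
        clinear_cscale[OF assms(1)])
qed (rule assms(3))

section \<open>Quotient modules\<close>

lemma coset_in_quotient_carrier: "u \<in> U \<Longrightarrow> u +o W \<in> quotient_carrier U W"
  by (simp add: quotient_carrier_def)

lemma quotient_carrier_cases:
  assumes "S \<in> quotient_carrier U W"
  obtains u where "u \<in> U" "S = u +o W"
  using assms by (auto simp: quotient_carrier_def)

lemma quotient_map_cscale_coset:
  assumes "cpm.subspace W"
  shows "quotient_map W (cscale c) (a +o W) = cscale c a +o W"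
  by (rule quotient_map_coset[OF clinear_scale_const assms assms])
    (auto intro: cpm.subspace_scale[OF assms])

lemma cring_complex_field: "cring complex_field"
proof (rule cringI)
  show "abelian_group complex_field"
    by (rule abelian_groupI) (auto simp: complex_field_def intro: exI[of _ "- _"] add.left_inverse)
  show "Group.comm_monoid complex_field"
    by (rule comm_monoidI) (auto simp: complex_field_def)
qed (simp add: complex_field_def distrib_right)

lemma quotient_rep_simps [simp]:
  "carrier (quotient_rep U W \<rho>) = quotient_carrier U W"
  "zero (quotient_rep U W \<rho>) = W"
  "add (quotient_rep U W \<rho>) = (+)"
  "smult (quotient_rep U W \<rho>) = (\<lambda>c. quotient_map W (cscale c))"
  "act (quotient_rep U W \<rho>) = \<rho>"
  by (simp_all add: quotient_rep_def)

lemma abelian_group_quotient_rep: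
  assumes U: "cpm.subspace U" and W: "cpm.subspace W"
  shows "abelian_group (quotient_rep U W \<rho>)"
proof (rule abelian_groupI)
  show "\<zero>\<^bsub>quotient_rep U W \<rho>\<^esub> \<in> carrier (quotient_rep U W \<rho>)"
    using coset_in_quotient_carrier[OF cpm.subspace_0[OF U], of W] by simp
next
  fix S assume "S \<in> carrier (quotient_rep U W \<rho>)"
  then obtain u where u: "u \<in> U" "S = u +o W"
    by (auto elim: quotient_carrier_cases)
  show "\<zero>\<^bsub>quotient_rep U W \<rho>\<^esub> \<oplus>\<^bsub>quotient_rep U W \<rho>\<^esub> S = S"
    using coset_add[OF W, of 0 u] u by simp
  show "\<exists>T\<in>carrier (quotient_rep U W \<rho>).
      T \<oplus>\<^bsub>quotient_rep U W \<rho>\<^esub> S = \<zero>\<^bsub>quotient_rep U W \<rho>\<^esub>"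
    using coset_add[OF W, of "- u" u] u cpm.subspace_neg[OF U u(1)]
    by (auto intro!: bexI[of _ "(- u) +o W"] coset_in_quotient_carrier)
qed (auto elim!: quotient_carrier_cases simp: coset_add[OF W] add_ac
    intro!: coset_in_quotient_carrier cpm.subspace_add[OF U])

lemma module_quotient_rep:
  assumes U: "cpm.subspace U" and W: "cpm.subspace W"
  shows "Module.module complex_field (quotient_rep U W \<rho>)"
  by (rule moduleI[OF cring_complex_field abelian_group_quotient_rep[OF U W]])
    (auto elim!: quotient_carrier_cases
      simp: complex_field_def coset_add[OF W] quotient_map_cscale_coset[OF W]
        cpm.scale_left_distrib cpm.scale_right_distrib
      intro!: coset_in_quotient_carrier cpm.subspace_scale[OF U])

text \<open>The additive inverse is identified by uniqueness, through a sum equal to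
  \<open>W\<close>. This turns the bracket axiom of \<open>sp_module\<close> into an identity
  between representatives.\<close>

lemma quotient_rep_minus:
  assumes U: "cpm.subspace U" and W: "cpm.subspace W" and "u \<in> U" "v \<in> U"
  shows "(u +o W) \<ominus>\<^bsub>quotient_rep U W \<rho>\<^esub> (v +o W) = (u - v) +o W"
proof -
  interpret abelian_group "quotient_rep U W \<rho>"
    by (rule abelian_group_quotient_rep[OF U W])
  have "\<ominus>\<^bsub>quotient_rep U W \<rho>\<^esub> (v +o W) = (- v) +o W"
    using assms coset_add[OF W, of "- v" v] cpm.subspace_neg[OF U]
    by (intro minus_equality) (auto intro!: coset_in_quotient_carrier)
  then show ?thesis
    by (simp add: a_minus_def coset_add[OF W])
qed

section \<open>Actions on quotients given by operators on representatives\<close>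

text \<open>The operators \<open>A g\<close> live on the ambient space and satisfy the module
  identities exactly on \<open>U\<close>, not merely modulo \<open>W\<close>. Invariance of
  \<open>U \<inter> W\<close> is implicit in the formula for \<open>\<rho>\<close> on
  cosets.\<close>

definition lifts_sp_action ::
  "('k \<Rightarrow>\<^sub>0 complex) set \<Rightarrow> ('k \<Rightarrow>\<^sub>0 complex) set \<Rightarrow>
   ('d::finite cpoly \<Rightarrow> ('k \<Rightarrow>\<^sub>0 complex) set \<Rightarrow> ('k \<Rightarrow>\<^sub>0 complex) set) \<Rightarrow>
   ('d cpoly \<Rightarrow> ('k \<Rightarrow>\<^sub>0 complex) \<Rightarrow> ('k \<Rightarrow>\<^sub>0 complex)) \<Rightarrow> bool" where
  "lifts_sp_action U W \<rho> A \<longleftrightarrow>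
     (\<forall>g\<in>sp. clinear (A g)) \<and> (\<forall>g\<in>sp. \<forall>u\<in>U. A g u \<in> U) \<and>
     (\<forall>g\<in>sp. \<forall>u\<in>U. \<rho> g (u +o W) = A g u +o W) \<and>
     (\<forall>g\<in>sp. \<forall>h\<in>sp. \<forall>u\<in>U. A (g + h) u = A g u + A h u) \<and>
     (\<forall>g\<in>sp. \<forall>c. \<forall>u\<in>U. A (cscale c g) u = cscale c (A g u)) \<and>
     (\<forall>g\<in>sp. \<forall>h\<in>sp. poisson g h \<in> sp \<and>
        (\<forall>u\<in>U. A (poisson g h) u = A g (A h u) - A h (A g u)))"

lemma sp_module_quotient_rep:
  fixes A :: "'d::finite cpoly \<Rightarrow> ('k \<Rightarrow>\<^sub>0 complex) \<Rightarrow> ('k \<Rightarrow>\<^sub>0 complex)"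
  assumes U: "cpm.subspace U" and W: "cpm.subspace W" and A: "lifts_sp_action U W \<rho> A"
  shows "sp_module (quotient_rep U W \<rho>)"
proof -
  have lin: "clinear (A g)" if "g \<in> sp" for g
    using A that unfolding lifts_sp_action_def by blast
  have A': "g \<in> sp \<Longrightarrow> u \<in> U \<Longrightarrow> A g u \<in> U"
      "g \<in> sp \<Longrightarrow> u \<in> U \<Longrightarrow> \<rho> g (u +o W) = A g u +o W"
      "g \<in> sp \<Longrightarrow> h \<in> sp \<Longrightarrow> u \<in> U \<Longrightarrow> A (g + h) u = A g u + A h u"
      "g \<in> sp \<Longrightarrow> u \<in> U \<Longrightarrow> A (cscale c g) u = cscale c (A g u)"
      "g \<in> sp \<Longrightarrow> h \<in> sp \<Longrightarrow> poisson g h \<in> sp"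
      "g \<in> sp \<Longrightarrow> h \<in> sp \<Longrightarrow> u \<in> U \<Longrightarrow> A (poisson g h) u = A g (A h u) - A h (A g u)"
    for g h c u
    using A unfolding lifts_sp_action_def by blast+
  show ?thesis
    unfolding sp_module_def
    by (intro conjI ballI allI module_quotient_rep[OF U W])
      (auto elim!: quotient_carrier_cases
        simp: A' coset_add[OF W] quotient_map_cscale_coset[OF W] quotient_rep_minus[OF U W]
          clinear_add[OF lin] clinear_cscale[OF lin] cpm.subspace_add[OF U] cpm.subspace_scale[OF U]
          cpm.subspace_add[OF subspace_sp] cpm.subspace_scale[OF subspace_sp]
        intro!: coset_in_quotient_carrier)
qed

text \<open>\<open>W\<close> lies in \<open>U\<close>, but \<open>W'\<close> need not lie in
  \<open>U'\<close>: the target is \<open>U'\<close> modulo its intersection with \<open>W'\<close>,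
  written with full cosets of \<open>W'\<close>. Injectivity therefore comes from \<open>W\<close>
  being the preimage of \<open>W'\<close> within \<open>U\<close>, surjectivity from
  \<open>f\<close> mapping \<open>U\<close> onto \<open>U'\<close>.\<close>

lemma sp_module_iso_quotient_rep:
  fixes A :: "'d::finite cpoly \<Rightarrow> ('k \<Rightarrow>\<^sub>0 complex) \<Rightarrow> ('k \<Rightarrow>\<^sub>0 complex)"
    and A' :: "'d cpoly \<Rightarrow> ('l \<Rightarrow>\<^sub>0 complex) \<Rightarrow> ('l \<Rightarrow>\<^sub>0 complex)"
  assumes U: "cpm.subspace U" and W: "cpm.subspace W" and A: "lifts_sp_action U W \<rho> A"
    and U': "cpm.subspace U'" and W': "cpm.subspace W'" and A': "lifts_sp_action U' W' \<rho>' A'"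
    and f: "clinear f" "f ` U = U'" and ker: "W = {u \<in> U. f u \<in> W'}"
    and eq: "\<And>g u. g \<in> sp \<Longrightarrow> u \<in> U \<Longrightarrow> f (A g u) = A' g (f u)"
  shows "sp_module_iso (quotient_rep U W \<rho>) (quotient_rep U' W' \<rho>') (quotient_map W' f)"
proof -
  have coset: "quotient_map W' f (u +o W) = f u +o W'" for u
    using ker by (intro quotient_map_coset[OF f(1) W W']) auto
  have fU: "f u \<in> U'" if "u \<in> U" for u
    using f(2) that by blast
  have AU: "A g u \<in> U" "\<rho> g (u +o W) = A g u +o W" if "g \<in> sp" "u \<in> U" for g u
    using A that unfolding lifts_sp_action_def by blast+
  have AU': "\<rho>' g (u +o W') = A' g u +o W'" if "g \<in> sp" "u \<in> U'" for g u
    using A' that unfolding lifts_sp_action_def by blast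
  have "inj_on (quotient_map W' f) (quotient_carrier U W)"
  proof (rule inj_onI, elim quotient_carrier_cases)
    fix S T u v
    assume *: "quotient_map W' f S = quotient_map W' f T" "u \<in> U" "S = u +o W" "v \<in> U" "T = v +o W"
    then have "f (u - v) \<in> W'"
      by (simp add: coset coset_eq_iff[OF W'] clinear_diff[OF f(1)])
    moreover have "u - v \<in> U"
      using * cpm.subspace_diff[OF U] by blast
    ultimately have "u - v \<in> W"
      using ker by blast
    with * show "S = T"
      by (simp add: coset_eq_iff[OF W])
  qed
  moreover have "quotient_map W' f ` quotient_carrier U W = quotient_carrier U' W'"
    unfolding quotient_carrier_def f(2)[symmetric] by (simp add: image_image coset)
  ultimately have bij: "bij_betw (quotient_map W' f) (quotient_carrier U W) (quotient_carrier U' W')"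
    by (simp add: bij_betw_def)
  show ?thesis
    unfolding sp_module_iso_def
    by (intro conjI ballI allI sp_module_quotient_rep[OF U W A] sp_module_quotient_rep[OF U' W' A'])
      (auto simp: bij elim!: quotient_carrier_cases
        simp: coset AU AU' fU eq coset_add[OF W] coset_add[OF W'] quotient_map_cscale_coset[OF W]
          quotient_map_cscale_coset[OF W'] clinear_add[OF f(1)] clinear_cscale[OF f(1)])
qed

section \<open>The action of quadratic elements on the free algebra\<close>

lemma free_alg_deg_word:
  "length (letters u) = n \<Longrightarrow> basis u \<in> free_alg_deg n"
  by (simp add: free_alg_deg_def)

lemma subspace_free_alg_deg: "cpm.subspace (free_alg_deg n)"
  unfolding cpm.subspace_def free_alg_deg_def
  using Poly_Mapping.keys_add by (auto simp: in_keys_iff lookup_add)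

lemma subspace_tensor_power: "cpm.subspace (tensor_power n)"
  unfolding cpm.subspace_def tensor_power_def
  using Poly_Mapping.keys_add by (auto simp: in_keys_iff lookup_add)

lemma degree_two_cases:
  assumes "a \<in> free_alg_deg 2" "u \<in> Poly_Mapping.keys a"
  obtains p q where "u = Word [p, q]"
proof -
  have "length (letters u) = 2"
    using assms by (simp add: free_alg_deg_def)
  then show ?thesis
    using that by (cases u) (auto simp: numeral_2_eq_2 length_Suc_conv)
qed

lemma degree_two_eqI:
  assumes "a \<in> free_alg_deg 2" "clinear F" "clinear G"
    and "\<And>p q. F (basis (Word [p, q])) = G (basis (Word [p, q]))"
  shows "F a = G a"
proof (rule clinear_eq_on_keys[OF assms(2,3)])
  fix u assume "u \<in> Poly_Mapping.keys a"
  then obtain p q where "u = Word [p, q]"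
    by (rule degree_two_cases[OF assms(1)])
  then show "F (basis u) = G (basis u)"
    using assms(4) by simp
qed

section \<open>Derivations and brackets with two-letter words\<close>

lemma loday_one: "loday_bracket a 1 = 0"
  using loday_derivation[of a 1 1] by simp

text \<open>The letters generate the algebra and a derivation kills \<open>1\<close>, so the Leibniz
  rule carries agreement on letters to all words by induction.\<close>

lemma derivation_eqI:
  fixes F G :: "'d free_alg \<Rightarrow> 'd free_alg"
  assumes F: "clinear F" "\<And>a b. F (a * b) = a * F b + F a * b"
    and G: "clinear G" "\<And>a b. G (a * b) = a * G b + G a * b"
    and eq: "\<And>x. F (letter x) = G (letter x)"
  shows "F a = G a"
proof (rule clinear_eqI[OF F(1) G(1)])
  fix u :: "'d gen free_monoid"
  have one: "F 1 = 0" "G 1 = 0"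
    using F(2)[of 1 1] G(2)[of 1 1] by simp_all
  have "F (basis (Word w)) = G (basis (Word w))" for w
    by (induction w) (simp_all add: basis_Word_Nil one basis_Word_Cons F(2) G(2) eq)
  then show "F (basis u) = G (basis u)"
    by (metis free_monoid.collapse)
qed

text \<open>Contracting \<open>z\<close> with \<open>p\<close> leaves \<open>q\<close> in the left
  tensor factor, contracting it with \<open>q\<close> leaves \<open>p\<close> in the right one.
  Multiplication forgets this difference, so the result is symmetric in \<open>p\<close> and
  \<open>q\<close> and has the same shape as \<open>poisson_two_var\<close>.\<close>

lemma loday_two_letter:
  "loday_bracket (basis (Word [p, q])) (letter z) =
    cscale (pairing p z) (letter q) + cscale (pairing q z) (letter p)"
proof -
  have "loday_bracket (basis (Word [p, q])) (letter z) =
      mult2 (cscale (pairing p z) (basis (Word [q], Word [])) + cscale (pairing q z) (basis (Word [], Word [p])))"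
    unfolding loday_bracket_def letter_def dbracket_basis dbracket_words_def
    by (simp add: numeral_2_eq_2)
  then show ?thesis
    by (simp add: clinear_add[OF clinear_mult2] clinear_cscale[OF clinear_mult2] letter_def
        plus_free_monoid_def)
qed

lemma poisson_two_var:
  "poisson (var p * var q) (var z) = cscale (pairing p z) (var q) + cscale (pairing q z) (var p)"
proof -
  \<comment> \<open>The Leibniz rule is available in the second argument, so antisymmetry moves the
    product there.\<close>
  have "poisson (var p * var q) (var z) = - poisson (var z) (var p * var q)"
    by (rule poisson_antisym)
  also have "\<dots> = var p * poisson (var q) (var z) + poisson (var p) (var z) * var q"
    unfolding poisson_leibniz
    by (simp add: poisson_antisym[of "var z"])
  finally show ?thesis
    unfolding poisson_var single_0_central cscale_conv_mult by simp
qed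

lemma clinear_linear_to_alg: "clinear linear_to_alg"
  by (rule clinearI)
    (simp_all add: linear_to_alg_def lin_coeff_add lin_coeff_cscale cpm.scale_left_distrib
      sum.distrib cpm.scale_sum_right)

text \<open>For a two-letter word both sides are the same combination of its letters, and both are
  linear in \<open>a\<close>. This is the compatibility of the two actions in degree one.\<close>

lemma linear_to_alg_poisson:
  assumes "a \<in> free_alg_deg 2"
  shows "linear_to_alg (poisson (abelianize a) (var z)) = loday_bracket a (letter z)"
proof (rule degree_two_eqI[OF assms])
  show "clinear (\<lambda>a. linear_to_alg (poisson (abelianize a) (var z)))"
    by (intro clinear_compose[OF clinear_linear_to_alg]
        clinear_compose[OF clinear_poisson_left clinear_abelianize])
qed (simp_all add: clinear_loday_left abelianize_basis poisson_two_var loday_two_letter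
    clinear_add[OF clinear_linear_to_alg] clinear_cscale[OF clinear_linear_to_alg] linear_to_alg_var)

lemma subspace_linear_polys: "cpm.subspace linear_polys"
  by (simp add: linear_polys_def)

lemma var_in_linear_polys: "var x \<in> linear_polys"
  unfolding linear_polys_def by (intro cpm.span_base) simp

text \<open>Guarantees that acting on one entry of a pure tensor of letters again gives a tensor of
  vectors of \<open>V\<close>, to which the multilinear comparison applies.\<close>

lemma poisson_var_in_linear_polys:
  assumes "a \<in> free_alg_deg 2"
  shows "poisson (abelianize a) (var z) \<in> linear_polys"
proof (rule clinear_in_subspace[OF clinear_compose[OF clinear_poisson_left clinear_abelianize]
      subspace_linear_polys])
  fix u assume "u \<in> Poly_Mapping.keys a"
  then obtain p q where "u = Word [p, q]"
    by (rule degree_two_cases[OF assms])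
  then show "poisson (abelianize (basis u)) (var z) \<in> linear_polys"
    by (auto simp: abelianize_basis poisson_two_var intro!: cpm.subspace_add[OF subspace_linear_polys]
        cpm.subspace_scale[OF subspace_linear_polys] var_in_linear_polys)
qed

text \<open>A derivation is determined by its values on letters, and these depend on \<open>abelianize a\<close> only.\<close>

lemma loday_eq_if_abelianize_eq:
  fixes a b c :: "'d::finite free_alg"
  assumes "a \<in> free_alg_deg 2" "b \<in> free_alg_deg 2" "abelianize a = abelianize b"
  shows "loday_bracket a c = loday_bracket b c"
proof (rule derivation_eqI[of "loday_bracket a" "loday_bracket b"])
  show "loday_bracket a (letter x) = loday_bracket b (letter x)" for x
    using linear_to_alg_poisson[OF assms(1), of x] linear_to_alg_poisson[OF assms(2), of x] assms(3)
    by simp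
qed (rule clinear_loday_right loday_derivation)+

section \<open>Brackets of degree two elements and the Jacobi identity\<close>

text \<open>The Leibniz rule lets the word \<open>pq\<close> act on \<open>r\<close> and on
  \<open>s\<close> in place: each term replaces one letter, so word length two is preserved.\<close>

lemma loday_two_two:
  "loday_bracket (basis (Word [p, q])) (basis (Word [r, s])) =
     cscale (pairing p s) (basis (Word [r, q])) + cscale (pairing q s) (basis (Word [r, p])) +
     (cscale (pairing p r) (basis (Word [q, s])) + cscale (pairing q r) (basis (Word [p, s])))"
proof -
  have two: "basis (Word [x, y]) = letter x * letter y" for x y :: "'a gen"
    by (simp add: letter_def basis_mult plus_free_monoid_def)
  show ?thesis
    unfolding two[of r s] loday_derivation loday_two_letter
    by (simp add: two distrib_left distrib_right cscale_mult_left cscale_mult_right)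
qed

lemma loday_in_free_alg_deg_2:
  assumes "a \<in> free_alg_deg 2" "b \<in> free_alg_deg 2"
  shows "loday_bracket a b \<in> free_alg_deg 2"
proof -
  have "loday_bracket (basis u) (basis v) \<in> free_alg_deg 2"
    if uv: "u \<in> Poly_Mapping.keys a" "v \<in> Poly_Mapping.keys b" for u v
  proof -
    obtain p q where "u = Word [p, q]"
      using assms(1) uv(1) by (rule degree_two_cases)
    moreover obtain r s where "v = Word [r, s]"
      using assms(2) uv(2) by (rule degree_two_cases)
    ultimately show ?thesis
      by (auto simp: loday_two_two intro!: cpm.subspace_add[OF subspace_free_alg_deg]
          cpm.subspace_scale[OF subspace_free_alg_deg] free_alg_deg_word)
  qed
  then have "loday_bracket (basis u) b \<in> free_alg_deg 2" if "u \<in> Poly_Mapping.keys a" for u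
    by (rule clinear_in_subspace[OF clinear_loday_right subspace_free_alg_deg]) (use that in blast)
  then show ?thesis
    by (rule clinear_in_subspace[OF clinear_loday_left subspace_free_alg_deg])
qed

text \<open>The commutator of two derivations is a derivation, so both sides are derivations in
  \<open>c\<close> and it suffices to compare them on letters. There bilinearity in \<open>a\<close>
  and \<open>b\<close> reduces the claim to two-letter words, where it is an explicit identity in
  the pairings.\<close>

lemma loday_jacobi:
  fixes a b c :: "'d free_alg"
  assumes a: "a \<in> free_alg_deg 2" and b: "b \<in> free_alg_deg 2"
  shows "loday_bracket (loday_bracket a b) c =
    loday_bracket a (loday_bracket b c) - loday_bracket b (loday_bracket a c)"
proof (rule derivation_eqI[of "loday_bracket (loday_bracket a b)"
      "\<lambda>c. loday_bracket a (loday_bracket b c) - loday_bracket b (loday_bracket a c)"])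
  fix z :: "'d gen"
  note add = clinear_add[OF clinear_loday_left] clinear_add[OF clinear_loday_right]
    clinear_cscale[OF clinear_loday_left] clinear_cscale[OF clinear_loday_right]
  have 1: "loday_bracket (loday_bracket (basis (Word [p, q])) (basis (Word [r, s]))) (letter z) =
      loday_bracket (basis (Word [p, q])) (loday_bracket (basis (Word [r, s])) (letter z))
      - loday_bracket (basis (Word [r, s])) (loday_bracket (basis (Word [p, q])) (letter z))"
    for p q r s
    unfolding loday_two_two add loday_two_letter
    \<comment> \<open>The term in which \<open>rs\<close> acts last contracts \<open>r\<close>,
      \<open>s\<close> against \<open>p\<close>, \<open>q\<close> in the opposite order;
      antisymmetry of the pairing aligns it with the others.\<close>
    using pairing_antisym[of r p] pairing_antisym[of r q] pairing_antisym[of s p] pairing_antisym[of s q]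
    by (intro poly_mapping_eqI) (simp add: lookup_add lookup_minus algebra_simps)
  \<comment> \<open>The Jacobi defect on a fixed letter, bilinear in \<open>a\<close> and
    \<open>b\<close>. It vanishes first for a two-letter word in the left slot, then in
    general.\<close>
  define J where "J a b = loday_bracket (loday_bracket a b) (letter z)
      - (loday_bracket a (loday_bracket b (letter z)) - loday_bracket b (loday_bracket a (letter z)))"
    for a b :: "'d free_alg"
  have lin: "clinear (J a)" "clinear (\<lambda>a. J a b)" for a b
    by (rule clinearI; simp add: J_def add cpm.scale_right_diff_distrib)+
  have "J (basis (Word [p, q])) b = 0" for p q
    by (rule degree_two_eqI[OF b lin(1) clinear_zero]) (simp add: J_def 1)
  then have "J a b = 0"
    by (rule degree_two_eqI[OF a lin(2) clinear_zero])
  then show "loday_bracket (loday_bracket a b) (letter z) =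
      loday_bracket a (loday_bracket b (letter z)) - loday_bracket b (loday_bracket a (letter z))"
    by (simp add: J_def)
next
  show "clinear (\<lambda>c. loday_bracket a (loday_bracket b c) - loday_bracket b (loday_bracket a c))"
    by (rule clinearI) (simp_all add: clinear_add[OF clinear_loday_right]
      clinear_cscale[OF clinear_loday_right] cpm.scale_right_diff_distrib)
  show "loday_bracket a (loday_bracket b (c * d)) - loday_bracket b (loday_bracket a (c * d)) =
      c * (loday_bracket a (loday_bracket b d) - loday_bracket b (loday_bracket a d)) +
      (loday_bracket a (loday_bracket b c) - loday_bracket b (loday_bracket a c)) * d" for c d
    unfolding loday_derivation clinear_add[OF clinear_loday_right]
    by (simp add: algebra_simps)
qed (rule clinear_loday_right loday_derivation)+

section \<open>Lifting quadratic polynomials to the free algebra\<close>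

text \<open>A chosen representative in \<open>A\<close> of the necklace identified with
  \<open>g\<close>. The choice is arbitrary and need not be linear in \<open>g\<close>; linearity is
  shown only for the bracket with it.\<close>

definition quadratic_lift :: "'d::finite cpoly \<Rightarrow> 'd free_alg" where
  "quadratic_lift g = (SOME a. a \<in> free_alg_deg 2 \<and> abelianize a = g
     \<and> inv_into (necklace 2) necklace_to_poly g = a +o commutators)"

lemma quadratic_lift:
  assumes "g \<in> sp"
  shows "quadratic_lift g \<in> free_alg_deg 2" "abelianize (quadratic_lift g) = g"
    "inv_into (necklace 2) necklace_to_poly g = quadratic_lift g +o commutators"
proof -
  have "g \<in> necklace_to_poly ` necklace 2"
    using bij_betw_necklace_to_poly assms by (auto simp: bij_betw_def)
  then have "inv_into (necklace 2) necklace_to_poly g \<in> necklace 2"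
      "necklace_to_poly (inv_into (necklace 2) necklace_to_poly g) = g"
    by (rule inv_into_into, rule f_inv_into_f)
  then have "\<exists>a. a \<in> free_alg_deg 2 \<and> abelianize a = g
      \<and> inv_into (necklace 2) necklace_to_poly g = a +o commutators"
    by (metis necklace_def necklace_to_poly_coset quotient_carrier_cases)
  from someI_ex[OF this] show "quadratic_lift g \<in> free_alg_deg 2" "abelianize (quadratic_lift g) = g"
    "inv_into (necklace 2) necklace_to_poly g = quadratic_lift g +o commutators"
    unfolding quadratic_lift_def by blast+
qed

lemma abelianize_degree_two:
  fixes a :: "'d::finite free_alg"
  assumes "a \<in> free_alg_deg 2"
  shows "abelianize a \<in> sp"
proof -
  have "a +o commutators \<in> necklace 2"
    unfolding necklace_def by (rule coset_in_quotient_carrier[OF assms])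
  then show ?thesis
    using bij_betw_necklace_to_poly[where ?'d = 'd] necklace_to_poly_coset[of a]
    by (metis bij_betwE)
qed

text \<open>Makes the choice of lift harmless: any degree two element with the right abelianization
  gives the same derivation.\<close>

lemma loday_quadratic_lift:
  assumes "a \<in> free_alg_deg 2"
  shows "loday_bracket (quadratic_lift (abelianize a)) c = loday_bracket a c"
  by (rule loday_eq_if_abelianize_eq[OF quadratic_lift(1)[OF abelianize_degree_two[OF assms]] assms
        quadratic_lift(2)[OF abelianize_degree_two[OF assms]]])

lemma sp_lift_cases:
  fixes g :: "'d::finite cpoly"
  assumes "g \<in> sp"
  obtains a where "a \<in> free_alg_deg 2" "g = abelianize a"
  using quadratic_lift[OF assms] by metis

text \<open>Abelianization turns the Loday bracket of lifts into the Poisson bracket, and the Loday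
  bracket preserves degree two.\<close>

lemma poisson_sp:
  assumes "g \<in> sp" "h \<in> sp"
  shows "poisson g h \<in> sp"
proof -
  from assms(1) obtain a where "a \<in> free_alg_deg 2" "g = abelianize a"
    by (rule sp_lift_cases)
  moreover from assms(2) obtain b where "b \<in> free_alg_deg 2" "h = abelianize b"
    by (rule sp_lift_cases)
  ultimately show ?thesis
    using abelianize_degree_two[OF loday_in_free_alg_deg_2[of a b]] by (simp add: abelianize_loday)
qed

text \<open>The sum of the two lifts has degree two and abelianization \<open>g + h\<close>, so it
  brackets like the lift of \<open>g + h\<close>.\<close>

lemma loday_quadratic_lift_add:
  assumes "g \<in> sp" "h \<in> sp"
  shows "loday_bracket (quadratic_lift (g + h)) c =
    loday_bracket (quadratic_lift g) c + loday_bracket (quadratic_lift h) c"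
  using loday_quadratic_lift[OF cpm.subspace_add[OF subspace_free_alg_deg
      quadratic_lift(1)[OF assms(1)] quadratic_lift(1)[OF assms(2)]], of c]
  by (simp add: clinear_add[OF clinear_abelianize] clinear_add[OF clinear_loday_left]
      quadratic_lift(2) assms)

lemma loday_quadratic_lift_cscale:
  assumes "g \<in> sp"
  shows "loday_bracket (quadratic_lift (cscale k g)) c = cscale k (loday_bracket (quadratic_lift g) c)"
  using loday_quadratic_lift[OF cpm.subspace_scale[OF subspace_free_alg_deg
      quadratic_lift(1)[OF assms]], of k c]
  by (simp add: clinear_cscale[OF clinear_abelianize] clinear_cscale[OF clinear_loday_left]
      quadratic_lift(2) assms)

text \<open>The bracket of the two lifts abelianizes to \<open>poisson g h\<close>, so it can
  replace the lift; the Jacobi identity finishes.\<close>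

lemma loday_quadratic_lift_poisson:
  assumes "g \<in> sp" "h \<in> sp"
  shows "loday_bracket (quadratic_lift (poisson g h)) c =
    loday_bracket (quadratic_lift g) (loday_bracket (quadratic_lift h) c)
    - loday_bracket (quadratic_lift h) (loday_bracket (quadratic_lift g) c)"
  using loday_quadratic_lift[OF loday_in_free_alg_deg_2[OF
      quadratic_lift(1)[OF assms(1)] quadratic_lift(1)[OF assms(2)]], of c]
  by (simp add: abelianize_loday quadratic_lift assms loday_jacobi)

section \<open>Tensors as elements of the free algebra\<close>

text \<open>The map \<open>\<theta>\<close>, taken on tensors of all lengths at once, since lists
  index the bases of both sides.\<close>

definition tensor_to_alg :: "'d tensors \<Rightarrow> 'd free_alg" where
  "tensor_to_alg = lin_ext (\<lambda>w. basis (Word w))"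

definition alg_to_tensor :: "'d free_alg \<Rightarrow> 'd tensors" where
  "alg_to_tensor = lin_ext (\<lambda>u. basis (letters u))"

lemma clinear_tensor_to_alg: "clinear tensor_to_alg"
  and clinear_alg_to_tensor: "clinear alg_to_tensor"
  unfolding tensor_to_alg_def alg_to_tensor_def by (rule clinear_lin_ext)+

lemma tensor_to_alg_basis [simp]: "tensor_to_alg (basis w) = basis (Word w)"
  and alg_to_tensor_basis [simp]: "alg_to_tensor (basis u) = basis (letters u)"
  by (simp_all add: tensor_to_alg_def alg_to_tensor_def)

lemma alg_to_tensor_tensor_to_alg [simp]: "alg_to_tensor (tensor_to_alg t) = t"
  by (rule clinear_eqI[OF clinear_compose[OF clinear_alg_to_tensor clinear_tensor_to_alg] clinear_id])
    simp

lemma tensor_to_alg_alg_to_tensor [simp]: "tensor_to_alg (alg_to_tensor a) = a"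
  by (rule clinear_eqI[OF clinear_compose[OF clinear_tensor_to_alg clinear_alg_to_tensor] clinear_id])
    simp

text \<open>Serves to check identities between tensors inside the free algebra, where the action is
  a bracket.\<close>

lemma tensor_to_alg_eq_iff: "tensor_to_alg s = tensor_to_alg t \<longleftrightarrow> s = t"
  by (metis alg_to_tensor_tensor_to_alg)

lemma tensor_to_alg_image: "tensor_to_alg ` tensor_power n = (free_alg_deg n :: 'd free_alg set)"
proof
  have "tensor_to_alg t \<in> free_alg_deg n" if "t \<in> tensor_power n" for t :: "'d tensors"
    by (rule clinear_in_subspace[OF clinear_tensor_to_alg subspace_free_alg_deg])
      (use that in \<open>auto simp: tensor_power_def free_alg_deg_def\<close>)
  then show "tensor_to_alg ` tensor_power n \<subseteq> (free_alg_deg n :: 'd free_alg set)"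
    by blast
  have "alg_to_tensor a \<in> tensor_power n" if "a \<in> free_alg_deg n" for a :: "'d free_alg"
    by (rule clinear_in_subspace[OF clinear_alg_to_tensor subspace_tensor_power])
      (use that in \<open>auto simp: tensor_power_def free_alg_deg_def\<close>)
  then show "(free_alg_deg n :: 'd free_alg set) \<subseteq> tensor_to_alg ` tensor_power n"
    by (metis imageI subsetI tensor_to_alg_alg_to_tensor)
qed

text \<open>Both sides are multilinear in the entries, so they are compared on letters, where a word
  is the product of its letters.\<close>

lemma tensor_to_alg_pure_tensor:
  fixes vs :: "'d::finite cpoly list"
  assumes "set vs \<subseteq> linear_polys"
  shows "tensor_to_alg (pure_tensor vs) = prod_list (map linear_to_alg vs)"
proof (rule multilinear_eqI[where n = "length vs", OF _ _ _ refl assms])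
  show "multilinear (length vs) (\<lambda>vs :: 'd cpoly list. tensor_to_alg (pure_tensor vs))"
    unfolding multilinear_def
  proof (intro allI impI)
    fix us :: "'d cpoly list" and i
    assume "length us = length vs \<and> i < length vs"
    then have "clinear (\<lambda>u. pure_tensor (us[i := u]))"
      using multilinear_pure_tensor unfolding multilinear_def by blast
    then show "clinear (\<lambda>u. tensor_to_alg (pure_tensor (us[i := u])))"
      by (rule clinear_compose[OF clinear_tensor_to_alg])
  qed
  have "clinear (\<lambda>u. prod_list (map linear_to_alg (us[i := u])))" if "i < length us"
    for us :: "'d cpoly list" and i
  proof -
    \<comment> \<open>Splitting the product around position \<open>i\<close> exhibits it as linear
      in that factor.\<close>
    have "clinear (\<lambda>u. prod_list (map linear_to_alg (take i us)) *
        (linear_to_alg u * prod_list (map linear_to_alg (drop (Suc i) us))))"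
      by (rule clinear_compose[OF clinear_mult_right
            clinear_compose[OF clinear_mult_left clinear_linear_to_alg]])
    then show ?thesis
      using that by (simp add: upd_conv_take_nth_drop)
  qed
  then show "multilinear (length vs) (\<lambda>vs :: 'd cpoly list. prod_list (map linear_to_alg vs))"
    unfolding multilinear_def by simp
next
  fix w :: "'d gen list"
  have "basis (Word w) = prod_list (map letter w)"
    by (induction w) (simp_all add: basis_Word_Nil basis_Word_Cons)
  then show "tensor_to_alg (pure_tensor (map var w)) = prod_list (map linear_to_alg (map var w))"
    by (simp add: pure_tensor_var linear_to_alg_var comp_def)
qed

lemma clinear_tensor_act: "clinear (tensor_act g)"
  unfolding tensor_act_def by (rule clinear_lin_ext)

text \<open>Both sides are given by extending the action on letters as a derivation.\<close>

lemma tensor_to_alg_tensor_act: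
  assumes a: "a \<in> free_alg_deg 2"
  shows "tensor_to_alg (tensor_act (abelianize a) t) = loday_bracket a (tensor_to_alg t)"
proof (rule clinear_eqI[OF clinear_compose[OF clinear_tensor_to_alg clinear_tensor_act]
      clinear_compose[OF clinear_loday_right clinear_tensor_to_alg]])
  define P where "P x = poisson (abelianize a) (var x)" for x
  have word: "basis (Word w) = prod_list (map linear_to_alg (map var w))" for w :: "'a gen list"
    by (induction w) (simp_all add: basis_Word_Nil basis_Word_Cons linear_to_alg_var)
  fix w
  have "set ((map var w)[i := P x]) \<subseteq> linear_polys" for i x
    unfolding P_def using poisson_var_in_linear_polys[OF a] var_in_linear_polys
    by (intro subset_trans[OF set_update_subset_insert]) auto
  then have "tensor_to_alg (tensor_act (abelianize a) (basis w)) =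
      (\<Sum>i<length w. prod_list (map linear_to_alg ((map var w)[i := P (w ! i)])))"
    by (simp add: tensor_act_def clinear_sum[OF clinear_tensor_to_alg] tensor_to_alg_pure_tensor
        del: map_update flip: P_def)
  also have "\<dots> = loday_bracket a (basis (Word w))"
  proof (induction w)
    case Nil
    show ?case by (simp add: basis_Word_Nil loday_one)
  next
    case (Cons x w)
    \<comment> \<open>The summand at index \<open>0\<close> acts on the first letter; in all others
      the first letter factors out. This is the Leibniz rule for \<open>letter x\<close> times the
      remaining word.\<close>
    have "(\<Sum>i<length (x # w). prod_list (map linear_to_alg ((map var (x # w))[i := P ((x # w) ! i)]))) =
        linear_to_alg (P x) * prod_list (map linear_to_alg (map var w)) +
        letter x * (\<Sum>i<length w. prod_list (map linear_to_alg ((map var w)[i := P (w ! i)])))"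
      unfolding length_Cons sum.lessThan_Suc_shift
      by (simp add: linear_to_alg_var sum_distrib_left del: map_update)
    also have "\<dots> = loday_bracket a (basis (Word (x # w)))"
      unfolding Cons.IH word[of w, symmetric] basis_Word_Cons loday_derivation
      unfolding P_def linear_to_alg_poisson[OF a] by (rule add.commute)
    finally show ?case .
  qed
  finally show "tensor_to_alg (tensor_act (abelianize a) (basis w)) =
      loday_bracket a (tensor_to_alg (basis w))"
    by simp
qed

lemma tensor_to_alg_tensor_act_sp:
  assumes "g \<in> sp"
  shows "tensor_to_alg (tensor_act g t) = loday_bracket (quadratic_lift g) (tensor_to_alg t)"
  using tensor_to_alg_tensor_act[OF quadratic_lift(1)[OF assms]] quadratic_lift(2)[OF assms] by simp

lemma pure_tensor_in_tensor_power: "pure_tensor vs \<in> tensor_power (length vs)"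
  by (auto simp: tensor_power_def in_keys_iff lookup_pure_tensor split: if_splits)

lemma tensor_act_in_tensor_power:
  assumes "t \<in> tensor_power n"
  shows "tensor_act g t \<in> tensor_power n"
proof (rule clinear_in_subspace[OF clinear_tensor_act subspace_tensor_power])
  fix w assume "w \<in> Poly_Mapping.keys t"
  then have n: "n = length w"
    using assms by (simp add: tensor_power_def)
  have "pure_tensor ((map var w)[i := v]) \<in> tensor_power n" for i v
    using pure_tensor_in_tensor_power[of "(map var w)[i := v]"] by (simp add: n)
  then show "tensor_act g (basis w) \<in> tensor_power n"
    by (simp add: tensor_act_def cpm.subspace_sum[OF subspace_tensor_power])
qed

section \<open>Cyclic relations are commutators\<close>

lemma subspace_cyclic_relations: "cpm.subspace (cyclic_relations n)"
  by (simp add: cyclic_relations_def)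

text \<open>The difference telescopes into single rotations, each a generator of the relations
  applied to letters.\<close>

lemma rotate_in_cyclic_relations:
  "basis w - basis (rotate k w) \<in> cyclic_relations (length w)"
proof (induction k)
  case 0
  show ?case using cpm.subspace_0[OF subspace_cyclic_relations] by simp
next
  case (Suc k)
  have "pure_tensor (map var (rotate k w)) - pure_tensor (rotate1 (map var (rotate k w)))
      \<in> cyclic_relations (length w)"
    unfolding cyclic_relations_def using var_in_linear_polys
    by (intro cpm.span_base CollectI exI[of _ "map var (rotate k w)"]) auto
  then have "basis (rotate k w) - basis (rotate (Suc k) w) \<in> cyclic_relations (length w)"
    by (simp add: rotate1_map pure_tensor_var)
  from cpm.subspace_add[OF subspace_cyclic_relations Suc.IH this] show ?case by simp
qed

text \<open>Projection of \<open>A\<close> to degree \<open>n\<close>, read as a tensor. It is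
  needed because \<open>commutators\<close> mixes all degrees, so a degree \<open>n\<close> element
  of it may be written with commutators of other degrees.\<close>

definition homogeneous_part :: "nat \<Rightarrow> 'd free_alg \<Rightarrow> 'd tensors" where
  "homogeneous_part n = lin_ext (\<lambda>u. if length (letters u) = n then basis (letters u) else 0)"

lemma clinear_homogeneous_part: "clinear (homogeneous_part n)"
  unfolding homogeneous_part_def by (rule clinear_lin_ext)

lemma homogeneous_part_basis:
  "homogeneous_part n (basis u) = (if length (letters u) = n then basis (letters u) else 0)"
  by (simp add: homogeneous_part_def)

text \<open>For words \<open>u\<close> and \<open>v\<close>, the product \<open>vu\<close> is the
  rotation of \<open>uv\<close> by the length of \<open>u\<close>. The two have equal length, so
  either both survive the projection and differ by a cyclic relation, or both vanish.\<close>

lemma homogeneous_part_commutators: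
  assumes "c \<in> commutators"
  shows "homogeneous_part n c \<in> cyclic_relations n"
proof (rule clinear_span_in_subspace[OF clinear_homogeneous_part subspace_cyclic_relations _
      assms[unfolded commutators_def]])
  let ?P = "homogeneous_part n"
  note P = clinear_homogeneous_part[of n]
  note W = subspace_cyclic_relations[of n]
  have 1: "?P (basis u * basis v - basis v * basis u) \<in> cyclic_relations n" for u v
  proof (cases "length (letters u) + length (letters v) = n")
    case True
    then have "?P (basis u * basis v - basis v * basis u) =
        basis (letters u @ letters v) - basis (rotate (length (letters u)) (letters u @ letters v))"
      by (simp add: clinear_diff[OF P] basis_mult homogeneous_part_basis rotate_append)
    with True show ?thesis
      using rotate_in_cyclic_relations[of "letters u @ letters v"] by simp
  next
    case False
    then show ?thesis
      using cpm.subspace_0[OF W] by (simp add: clinear_diff[OF P] basis_mult homogeneous_part_basis add.commute)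
  qed
  \<comment> \<open>The case of words is extended linearly, first in the left factor and then in the
    right one.\<close>
  have 2: "?P (a * basis v - basis v * a) \<in> cyclic_relations n" for a v
    by (rule clinear_in_subspace[OF clinear_compose[OF P clinear_minus'[OF clinear_mult_left
              clinear_mult_right]] W 1])
  fix x assume "x \<in> {a * b - b * a | a b :: 'a free_alg. True}"
  then obtain a b where x: "x = a * b - b * a" by blast
  show "?P x \<in> cyclic_relations n"
    unfolding x
    by (rule clinear_in_subspace[OF clinear_compose[OF P clinear_minus'[OF clinear_mult_right
              clinear_mult_left]] W 2])
qed

text \<open>A generator of the relations maps to the commutator of its first entry with the product
  of the others. Conversely, projecting a commutator to degree \<open>n\<close> gives a cyclic
  relation.\<close>

lemma cyclic_relations_eq:
  "(cyclic_relations n :: 'd::finite tensors set) = {t \<in> tensor_power n. tensor_to_alg t \<in> commutators}"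
proof (intro equalityI subsetI CollectI conjI)
  fix t :: "'d tensors"
  assume "t \<in> cyclic_relations n"
  note t = this[unfolded cyclic_relations_def]
  have pure: "pure_tensor vs \<in> tensor_power n" if "length vs = n" for vs :: "'d cpoly list"
    using pure_tensor_in_tensor_power[of vs] that by simp
  show "t \<in> tensor_power n"
    by (rule clinear_span_in_subspace[OF clinear_id subspace_tensor_power _ t])
      (use pure in \<open>force intro!: cpm.subspace_diff[OF subspace_tensor_power]\<close>)
  show "tensor_to_alg t \<in> commutators"
  proof (rule clinear_span_in_subspace[OF clinear_tensor_to_alg subspace_commutators _ t])
    fix x :: "'d tensors"
    assume "x \<in> {pure_tensor vs - pure_tensor (rotate1 vs) |vs. length vs = n \<and> set vs \<subseteq> linear_polys}"
    then obtain vs where x: "x = pure_tensor vs - pure_tensor (rotate1 vs)" "set vs \<subseteq> linear_polys"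
      by blast
    show "tensor_to_alg x \<in> commutators"
    proof (cases vs)
      case Nil
      \<comment> \<open>For \<open>n = 0\<close> the rotation is trivial and the generator is
        zero.\<close>
      then show ?thesis
        using cpm.subspace_0[OF subspace_commutators] by (simp add: x clinear_0[OF clinear_tensor_to_alg])
    next
      case (Cons v us)
      then show ?thesis
        using x commutator_in[of "linear_to_alg v" "prod_list (map linear_to_alg us)"]
        by (simp add: clinear_diff[OF clinear_tensor_to_alg] tensor_to_alg_pure_tensor)
    qed
  qed
next
  fix t :: "'d tensors"
  assume t: "t \<in> {t \<in> tensor_power n. tensor_to_alg t \<in> commutators}"
  \<comment> \<open>The projection recovers \<open>t\<close> because \<open>t\<close> already has
    degree \<open>n\<close>.\<close>
  have "homogeneous_part n (tensor_to_alg t) = t"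
    by (rule clinear_eq_on_keys[OF clinear_compose[OF clinear_homogeneous_part clinear_tensor_to_alg]
          clinear_id])
      (use t in \<open>auto simp: homogeneous_part_basis tensor_power_def\<close>)
  with t show "t \<in> cyclic_relations n"
    using homogeneous_part_commutators[of "tensor_to_alg t" n] by simp
qed

section \<open>The two module structures and the isomorphism\<close>

text \<open>Since \<open>\<theta>\<close> is injective and intertwines the action with brackets by
  lifts, the module identities are pulled back from the free algebra.\<close>

lemma lifts_sp_action_tensors:
  "lifts_sp_action (tensor_power n :: 'd::finite tensors set) (cyclic_relations n)
     (\<lambda>g. quotient_map (cyclic_relations n) (tensor_act g)) tensor_act"
  unfolding lifts_sp_action_def
proof (intro conjI ballI allI)
  fix g :: "'d cpoly" and t :: "'d tensors"
  assume g: "g \<in> sp"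
  \<comment> \<open>The relations are the preimage of \<open>commutators\<close>, which every
    bracket preserves.\<close>
  have "tensor_act g ` cyclic_relations n \<subseteq> cyclic_relations n"
    unfolding cyclic_relations_eq
    by (auto simp: tensor_to_alg_tensor_act_sp[OF g] tensor_act_in_tensor_power loday_commutators_right)
  then show "quotient_map (cyclic_relations n) (tensor_act g) (t +o cyclic_relations n) =
      tensor_act g t +o cyclic_relations n"
    by (intro quotient_map_coset clinear_tensor_act subspace_cyclic_relations)
qed (simp_all add: clinear_tensor_act tensor_act_in_tensor_power poisson_sp
    tensor_to_alg_tensor_act_sp cpm.subspace_add[OF subspace_sp] cpm.subspace_scale[OF subspace_sp]
    clinear_add[OF clinear_tensor_to_alg] clinear_diff[OF clinear_tensor_to_alg]
    clinear_cscale[OF clinear_tensor_to_alg] loday_quadratic_lift_add loday_quadratic_lift_cscale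
    loday_quadratic_lift_poisson flip: tensor_to_alg_eq_iff)

lemma lifts_sp_action_necklace:
  "lifts_sp_action (free_alg_deg n :: 'd::finite free_alg set) commutators
     (\<lambda>g. necklace_bracket (inv_into (necklace 2) necklace_to_poly g))
     (\<lambda>g. loday_bracket (quadratic_lift g))"
  unfolding lifts_sp_action_def
proof (intro conjI ballI allI)
  fix g :: "'d cpoly" and a :: "'d free_alg"
  assume g: "g \<in> sp" and "a \<in> free_alg_deg n"
  \<comment> \<open>Preservation of degree is borrowed from the tensor side, where acting keeps the
    length.\<close>
  then obtain t where "t \<in> tensor_power n" "a = tensor_to_alg t"
    by (metis imageE tensor_to_alg_image)
  then show "loday_bracket (quadratic_lift g) a \<in> free_alg_deg n"
    using tensor_act_in_tensor_power[of t n g]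
    by (simp add: tensor_to_alg_image[symmetric] tensor_to_alg_tensor_act_sp[OF g, symmetric])
qed (simp_all add: clinear_loday_right quadratic_lift(3) necklace_bracket_coset poisson_sp
    loday_quadratic_lift_add loday_quadratic_lift_cscale loday_quadratic_lift_poisson)

theorem theorem4:
  fixes n :: nat
  shows "\<exists>\<Phi> :: 'd::finite tensors set \<Rightarrow> 'd free_alg set.
    sp_module_iso (cyclic_tensors n) (necklace_rep n) \<Phi> \<and>
    (\<forall>vs. length vs = n \<and> set vs \<subseteq> linear_polys \<longrightarrow>
      \<Phi> (pure_tensor vs +o cyclic_relations n) = prod_list (map linear_to_alg vs) +o commutators)"
proof (intro exI conjI allI impI)
  show "sp_module_iso (cyclic_tensors n) (necklace_rep n)
      (quotient_map commutators (tensor_to_alg :: 'd tensors \<Rightarrow> 'd free_alg))"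
    unfolding cyclic_tensors_def necklace_rep_def
    by (rule sp_module_iso_quotient_rep[where A = tensor_act
          and A' = "\<lambda>g. loday_bracket (quadratic_lift g)" and f = tensor_to_alg,
          OF subspace_tensor_power subspace_cyclic_relations lifts_sp_action_tensors
          subspace_free_alg_deg subspace_commutators lifts_sp_action_necklace
          clinear_tensor_to_alg tensor_to_alg_image cyclic_relations_eq tensor_to_alg_tensor_act_sp])
  fix vs :: "'d cpoly list"
  assume "length vs = n \<and> set vs \<subseteq> linear_polys"
  moreover have "tensor_to_alg ` cyclic_relations n \<subseteq> (commutators :: 'd free_alg set)"
    by (auto simp: cyclic_relations_eq)
  ultimately show "quotient_map commutators tensor_to_alg (pure_tensor vs +o cyclic_relations n) =
      prod_list (map linear_to_alg vs) +o commutators"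
    by (simp add: tensor_to_alg_pure_tensor quotient_map_coset clinear_tensor_to_alg
        subspace_cyclic_relations subspace_commutators)
qed

end
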